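(* Suppose that the generators of the Jacobi algebra (Lie algebra of the Jacobi group $G^J_1$) have the differential realization $$\mathbf{a}=\frac{\partial}{\partial z},\quad \mathbf{a}^{\dagger}=z+w\frac{\partial}{\partial z},\quad \mathbb{K}_-=\frac{\partial}{\partial w},\quad \mathbb{K}_0=k+\tfrac12 z\frac{\partial}{\partial z}+w\frac{\partial}{\partial w},\quad \mathbb{K}_+=\tfrac12 z^2+2kw+zw\frac{\partial}{\partial z}+w^2\frac{\partial}{\partial w},$$ where $z\in\mathbb{C}$, $|w|<1$. Then the conditions $$(\mathbf{a}f,g)=(f,\mathbf{a}^{\dagger}g),\qquad (\mathbb{K}_-f,g)=(f,\mathbb{K}_+g),\qquad (\mathbb{K}_0f,g)=(f,\mathbb{K}_0g)$$ with respect to the scalar product $$(f,g)=\frac{4k-3}{2\pi^2}\int_{z,w\in\mathbb{C},\,|w|<1}\overline{f(z,w)}\,g(z,w)\,\rho(z,w)\,\mathbf{d}^2z\,\mathbf{d}^2w$$ impose that the function $\rho$ verifies the equations $$\Big(w\frac{\partial}{\partial z}-\frac{\partial}{\partial\bar z}\Big)\rho=z\rho,$$ $$\Big(w^2\frac{\partial}{\partial w}-\frac{\partial}{\partial\bar w}\Big)\rho=\Big(\frac{z^2}{2}+pw-zw\frac{\partial}{\partial z}\Big)\rho,$$ $$2\Big(w\frac{\partial}{\partial w}-\bar w\frac{\partial}{\partial\bar w}\Big)\rho=\Big(\bar z\frac{\partial}{\partial\bar z}-z\frac{\partial}{\partial z}\Big)\rho,$$ with $p=2k-3$, and these equations admit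 the solution $$\rho(z,w)=(1-w\bar w)^{p}\exp\left[-\frac{2|z|^2+z^2\bar w+\bar z^2w}{2(1-|w|^2)}\right],\qquad p=2k-3.$$
   Context: The Jacobi group is $G^J_1=H_1\rtimes\mathrm{SU}(1,1)$, where $H_1$ is the 3-dimensional real Heisenberg-Weyl group; its Lie algebra is generated by $a,a^{\dagger},1$ (with $[a,a^{\dagger}]=1$) and the generators $K_0,K_\pm$ of $\mathrm{SU}(1,1)$. The number $k>0$ is the eigenvalue of $\mathbf{K}_0$ on the cyclic vector $e_0$ (which satisfies $\mathbf{a}e_0=0$, $\mathbf{K}_-e_0=0$, $\mathbf{K}_0e_0=ke_0$). The functions $f,g$ are holomorphic functions of $(z,w)$, $z\in\mathbb{C}$, $|w|<1$, on which the differential operators act. $\partial/\partial z,\partial/\partial\bar z,\partial/\partial w,\partial/\partial\bar w$ are the Wirtinger derivatives; on the right-hand side of the second equation, $zw\,\partial/\partial z$ acts on $\rho$. $\mathbf{d}^2z=d(\mathrm{Re}\,z)\,d(\mathrm{Im}\,z)$ and $\mathbf{d}^2w=d(\mathrm{Re}\,w)\,d(\mathrm{Im}\,w)$.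
   Formalization: For "the conditions impose the equations", ρ is taken real and continuously differentiable with (4k−3)ρ ≥ 0, all monomials in z, w are assumed to have finite norm, and 4k ≠ 3 (at 4k = 3 the scalar product is identically zero and the conditions say nothing about ρ). *)

theory Defs
  imports "HOL-Analysis.Analysis"
begin

text \<open>Points of the domain are pairs \<open>(z, w)\<close> with \<open>z\<close> arbitrary and \<open>|w| < 1\<close>.
  Functions are total on \<open>complex \<times> complex\<close>; only their values on this open set matter.\<close>

definition Dom :: "(complex \<times> complex) set" where
  "Dom = UNIV \<times> ball 0 1"

text \<open>Holomorphy in two variables: the real Frechet derivative exists and is complex linear
  (the product type carries only a real normed space structure in the library).\<close>

definition holomorphic2 :: "(complex \<times> complex \<Rightarrow> complex) \<Rightarrow> bool" where
  "holomorphic2 f \<longleftrightarrow>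
     (\<forall>x\<in>Dom. \<exists>A B. (f has_derivative (\<lambda>(h, l). A * h + B * l)) (at x))"

definition C1_on_Dom :: "(complex \<times> complex \<Rightarrow> real) \<Rightarrow> bool" where
  "C1_on_Dom \<rho> \<longleftrightarrow>
     (\<exists>\<rho>' :: complex \<times> complex \<Rightarrow> (complex \<times> complex) \<Rightarrow>\<^sub>L real.
        (\<forall>x\<in>Dom. (\<rho> has_derivative blinfun_apply (\<rho>' x)) (at x)) \<and> continuous_on Dom \<rho>')"

text \<open>Wirtinger derivatives \<open>(\<partial>\<^sub>x \<mp> \<i> \<partial>\<^sub>y) / 2\<close> in either variable, for real
  differentiable functions; the suffix \<open>b\<close> marks the derivative in the conjugate variable.\<close>

definition dz :: "(complex \<times> complex \<Rightarrow> complex) \<Rightarrow> complex \<times> complex \<Rightarrow> complex" where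
  "dz f x = (frechet_derivative f (at x) (1, 0) - \<i> * frechet_derivative f (at x) (\<i>, 0)) / 2"

definition dzb :: "(complex \<times> complex \<Rightarrow> complex) \<Rightarrow> complex \<times> complex \<Rightarrow> complex" where
  "dzb f x = (frechet_derivative f (at x) (1, 0) + \<i> * frechet_derivative f (at x) (\<i>, 0)) / 2"

definition dw :: "(complex \<times> complex \<Rightarrow> complex) \<Rightarrow> complex \<times> complex \<Rightarrow> complex" where
  "dw f x = (frechet_derivative f (at x) (0, 1) - \<i> * frechet_derivative f (at x) (0, \<i>)) / 2"

definition dwb :: "(complex \<times> complex \<Rightarrow> complex) \<Rightarrow> complex \<times> complex \<Rightarrow> complex" where
  "dwb f x = (frechet_derivative f (at x) (0, 1) + \<i> * frechet_derivative f (at x) (0, \<i>)) / 2"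

definition op_a :: "(complex \<times> complex \<Rightarrow> complex) \<Rightarrow> complex \<times> complex \<Rightarrow> complex" where
  "op_a f = (\<lambda>(z, w). dz f (z, w))"

definition op_adag :: "(complex \<times> complex \<Rightarrow> complex) \<Rightarrow> complex \<times> complex \<Rightarrow> complex" where
  "op_adag f = (\<lambda>(z, w). z * f (z, w) + w * dz f (z, w))"

definition op_Kminus :: "(complex \<times> complex \<Rightarrow> complex) \<Rightarrow> complex \<times> complex \<Rightarrow> complex" where
  "op_Kminus f = (\<lambda>(z, w). dw f (z, w))"

definition op_K0 :: "real \<Rightarrow> (complex \<times> complex \<Rightarrow> complex) \<Rightarrow> complex \<times> complex \<Rightarrow> complex" where
  "op_K0 k f = (\<lambda>(z, w).
     of_real k * f (z, w) + 1 / 2 * z * dz f (z, w) + w * dw f (z, w))"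

definition op_Kplus :: "real \<Rightarrow> (complex \<times> complex \<Rightarrow> complex) \<Rightarrow> complex \<times> complex \<Rightarrow> complex" where
  "op_Kplus k f = (\<lambda>(z, w).
     (1 / 2 * z\<^sup>2 + 2 * of_real k * w) * f (z, w) + z * w * dz f (z, w) + w\<^sup>2 * dw f (z, w))"

definition scalar_prod ::
  "real \<Rightarrow> (complex \<times> complex \<Rightarrow> real) \<Rightarrow>
   (complex \<times> complex \<Rightarrow> complex) \<Rightarrow> (complex \<times> complex \<Rightarrow> complex) \<Rightarrow> complex" where
  "scalar_prod k \<rho> f g =
     of_real ((4 * k - 3) / (2 * pi\<^sup>2)) *
     (LINT x:Dom|lborel. cnj (f x) * g x * of_real (\<rho> x))"

text \<open>The holomorphic functions of finite norm, on which \<open>scalar_prod k \<rho>\<close> is an absolutely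
  convergent integral when \<open>\<rho>\<close> has constant sign.\<close>

definition hol_L2 :: "(complex \<times> complex \<Rightarrow> real) \<Rightarrow> (complex \<times> complex \<Rightarrow> complex) set" where
  "hol_L2 \<rho> = {f. holomorphic2 f \<and> set_integrable lborel Dom (\<lambda>x. (cmod (f x))\<^sup>2 * \<rho> x)}"

text \<open>\<open>(A f, g) = (f, B g)\<close> with \<open>A\<close> and \<open>B\<close> on their maximal domains in \<open>hol_L2 \<rho>\<close>.\<close>

definition adjoint_cond ::
  "real \<Rightarrow> (complex \<times> complex \<Rightarrow> real) \<Rightarrow>
   ((complex \<times> complex \<Rightarrow> complex) \<Rightarrow> complex \<times> complex \<Rightarrow> complex) \<Rightarrow>
   ((complex \<times> complex \<Rightarrow> complex) \<Rightarrow> complex \<times> complex \<Rightarrow> complex) \<Rightarrow> bool" where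
  "adjoint_cond k \<rho> A B \<longleftrightarrow>
     (\<forall>f\<in>hol_L2 \<rho>. \<forall>g\<in>hol_L2 \<rho>. A f \<in> hol_L2 \<rho> \<longrightarrow> B g \<in> hol_L2 \<rho> \<longrightarrow>
        scalar_prod k \<rho> (A f) g = scalar_prod k \<rho> f (B g))"

definition weight_equations :: "real \<Rightarrow> (complex \<times> complex \<Rightarrow> real) \<Rightarrow> bool" where
  "weight_equations p \<rho> \<longleftrightarrow>
     (let r = (\<lambda>x. complex_of_real (\<rho> x)) in
      \<forall>(z, w)\<in>Dom.
        w * dz r (z, w) - dzb r (z, w) = z * r (z, w) \<and>
        w\<^sup>2 * dw r (z, w) - dwb r (z, w) =
          (z\<^sup>2 / 2 + of_real p * w) * r (z, w) - z * w * dz r (z, w) \<and>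
        2 * (w * dw r (z, w) - cnj w * dwb r (z, w)) =
          cnj z * dzb r (z, w) - z * dz r (z, w))"

text \<open>The argument of \<open>Re\<close> is a real number, and \<open>1 - w * cnj w\<close> is written
  \<open>1 - (cmod w)\<^sup>2\<close>, so that the weight is real valued.\<close>

definition weight_solution :: "real \<Rightarrow> complex \<times> complex \<Rightarrow> real" where
  "weight_solution p = (\<lambda>(z, w).
     (1 - (cmod w)\<^sup>2) powr p *
     exp (- (Re (2 * of_real ((cmod z)\<^sup>2) + z\<^sup>2 * cnj w + (cnj z)\<^sup>2 * w) /
             (2 * (1 - (cmod w)\<^sup>2)))))"

end

(*
  The adjointness relations on monomials say that (X P - q P) rho integrates to 0 for every
  polynomial P in z, cnj z, w, cnj w, where X is a first order complex vector field and q a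
  polynomial; formally integrating by parts, this is the claimed equation in weak form.  The weight
  need not vanish at the boundary and polynomials are not test functions, so the relation has to be
  extended to bump functions first.  The adjoint of a gives the moment bound
  (z^n, z^n) <= 2 n (z^(n-1), z^(n-1)), hence exp(|z|^2 / 4) is integrable against rho.  Therefore
  P may be multiplied by the power series of exp(-|z - z0|^2 / 32), and then, by Weierstrass
  approximation in C^1, by f(exp(-|z - z0|^2 / 32)) g(|w - w0|^2) for arbitrary C^1 functions f, g.
  Suitable f and g give bumps concentrated at (z0, w0), for which integration by parts is legitimate.
*)

theory Submission
  imports Defs
begin

section \<open>Integration by parts\<close>

text \<open>Mixed monomials arise by polarisation: for f = z^b w^d and g = z^a w^c the product cnj f
  * g is z^a zbar^b w^c wbar^d. Derivatives in z, w ignore cnj f and those in zbar, wbar ignore g,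
  so each adjointness relation is a first order operator applied to this single product. The
  Gaussian in z is there because Weierstrass approximation needs a compact interval: |z - z0|^2 is
  unbounded, its Gaussian lies in (0, 1], while |w - w0|^2 is already bounded on the disc. The
  constants are a budget for dominated convergence. The moment bound permits every rate below 1/2 in
  exp(c |z|^2); the choice is 1/4. Half of it absorbs the fixed \<open>tame\<close> factors. The
  other 1/8 is for the approximants: 1/16 for the derivative of the inner function, 1/16 for the
  power series, whose partial sums are only dominated by the exponential of |z - z0|^2 / 32 \<le>
  |z|^2 / 16 + |z0|^2 / 16. The shift from 2k to p = 2k - 3 is the divergence 3w of the field zw
  d/dz + w^2 d/dw in \<open>op_Kplus\<close>.\<close>

lemma integral_lborel_translation:
  fixes F :: "'a::euclidean_space \<Rightarrow> 'b::{banach, second_countable_topology}"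
  assumes "F \<in> borel_measurable borel"
  shows "integral\<^sup>L lborel (\<lambda>x. F (c + x)) = integral\<^sup>L lborel F"
proof -
  have "integral\<^sup>L (distr lborel borel ((+) c)) F = integral\<^sup>L lborel (\<lambda>x. F (c + x))"
    by (rule integral_distr) (use assms in auto)
  then show ?thesis
    by (simp add: lborel_distr_plus)
qed

lemma integrable_compact_support:
  fixes F :: "'a::euclidean_space \<Rightarrow> 'b::{banach, second_countable_topology}"
  assumes "compact K" and "continuous_on UNIV F" and "\<And>x. x \<notin> K \<Longrightarrow> F x = 0"
  shows "integrable lborel F"
proof -
  have "integrable lborel (\<lambda>x. indicator K x *\<^sub>R F x)"
    using assms(1) continuous_on_subset[OF assms(2)] by (intro borel_integrable_compact) auto
  moreover have "(\<lambda>x. indicator K x *\<^sub>R F x) = F"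
    using assms(3) by (auto simp: indicator_def fun_eq_iff)
  ultimately show ?thesis by simp
qed

lemma bounded_compact_support:
  fixes F :: "'a::topological_space \<Rightarrow> 'b::real_normed_vector"
  assumes "compact K" and "continuous_on UNIV F" and "\<And>x. x \<notin> K \<Longrightarrow> F x = 0"
  obtains B where "B \<ge> 0" and "\<And>x. norm (F x) \<le> B"
proof -
  have "compact (F ` K)"
    using assms by (intro compact_continuous_image continuous_on_subset[OF assms(2)]) auto
  then have "bounded (F ` K)" by (rule compact_imp_bounded)
  then obtain B where B: "\<And>y. y \<in> F ` K \<Longrightarrow> norm y \<le> B"
    unfolding bounded_iff by blast
  have "norm (F x) \<le> max B 0" for x
    using B[of "F x"] assms(3)[of x] by (cases "x \<in> K") auto
  then show ?thesis by (intro that[of "max B 0"]) auto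
qed

lemma has_derivative_eq_0_outside:
  assumes "compact K" and "\<And>x. x \<notin> K \<Longrightarrow> F x = 0" and "(F has_derivative F') (at x)" and "x \<notin> K"
  shows "F' = (\<lambda>_. 0)"
proof -
  have "open (- K)" using assms(1) by (simp add: compact_imp_closed open_Compl)
  then have "(F has_derivative (\<lambda>_. 0)) (at x)"
    by (rule has_derivative_transform_within_open[OF has_derivative_const[of 0]])
      (use assms(2,4) in simp_all)
  then show ?thesis
    by (rule has_derivative_unique[OF assms(3)])
qed

text \<open>The integral of a difference quotient vanishes by translation invariance.\<close>

lemma integral_directional_derivative_eq_0:
  fixes F :: "'a::euclidean_space \<Rightarrow> 'b::{banach, second_countable_topology}"
  assumes K: "compact K" and F0: "\<And>x. x \<notin> K \<Longrightarrow> F x = 0"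
    and der: "\<And>x. (F has_derivative F' x) (at x)"
    and cont: "continuous_on UNIV (\<lambda>x. F' x v)"
  shows "integral\<^sup>L lborel (\<lambda>x. F' x v) = 0"
proof -
  have contF: "continuous_on UNIV F"
    by (intro continuous_at_imp_continuous_on ballI has_derivative_continuous[OF der])
  have F'0: "F' x v = 0" if "x \<notin> K" for x
    using fun_cong[OF has_derivative_eq_0_outside[OF K F0 der that]] by simp
  obtain B where B: "B \<ge> 0" "\<And>x. norm (F' x v) \<le> B"
    using bounded_compact_support[OF K cont F'0] by blast
  have line_der: "((\<lambda>s. F (s *\<^sub>R v + x)) has_derivative (\<lambda>h. F' (s *\<^sub>R v + x) (h *\<^sub>R v))) (at s)"
    for s x
  proof -
    have "((\<lambda>s. s *\<^sub>R v + x) has_derivative (\<lambda>h. h *\<^sub>R v)) (at s)"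
      by (auto intro!: derivative_eq_intros)
    then show ?thesis
      using has_derivative_compose[of "\<lambda>s. s *\<^sub>R v + x" "\<lambda>h. h *\<^sub>R v" s UNIV F "F' (s *\<^sub>R v + x)"] der
      by simp
  qed
  have lip: "norm (F (t *\<^sub>R v + x) - F x) \<le> B * t" if "t \<ge> 0" for t x
  proof -
    have "norm (F (t *\<^sub>R v + x) - F (0 *\<^sub>R v + x)) \<le> B * norm (t - 0)"
    proof (rule differentiable_bound[of UNIV "\<lambda>s. F (s *\<^sub>R v + x)" "\<lambda>s h. F' (s *\<^sub>R v + x) (h *\<^sub>R v)"])
      show "((\<lambda>s. F (s *\<^sub>R v + x)) has_derivative (\<lambda>h. F' (s *\<^sub>R v + x) (h *\<^sub>R v))) (at s within UNIV)" for s
        using line_der .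
      show "onorm (\<lambda>h. F' (s *\<^sub>R v + x) (h *\<^sub>R v)) \<le> B" for s
      proof (rule onorm_bound)
        fix h :: real
        have "F' (s *\<^sub>R v + x) (h *\<^sub>R v) = h *\<^sub>R F' (s *\<^sub>R v + x) v"
          by (rule linear_cmul[OF has_derivative_linear[OF der]])
        then show "norm (F' (s *\<^sub>R v + x) (h *\<^sub>R v)) \<le> B * norm h"
          using mult_left_mono[OF B(2)[of "s *\<^sub>R v + x"], of "\<bar>h\<bar>"] by (simp add: mult.commute)
      qed (use B in auto)
    qed auto
    then show ?thesis using that by simp
  qed
  define D where "D n x = real (Suc n) *\<^sub>R (F ((1 / real (Suc n)) *\<^sub>R v + x) - F x)" for n x
  \<comment> \<open>\<open>L\<close> is \<open>K\<close> swept backwards along \<open>v\<close>. The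
    increments \<open>1 / real (Suc n)\<close> never exceed 1, so all difference quotients vanish
    outside \<open>L\<close>, and by \<open>lip\<close> the constant \<open>B\<close> on
    \<open>L\<close> is an integrable majorant.\<close>
  define L where "L = {x - y | x y. x \<in> K \<and> y \<in> (\<lambda>s. s *\<^sub>R v) ` {0..1::real}}"
  have L: "compact L"
    unfolding L_def using K
    by (rule compact_differences) (intro compact_continuous_image continuous_intros compact_Icc)
  have contD: "continuous_on UNIV (D n)" for n
    unfolding D_def by (intro continuous_intros continuous_on_compose2[OF contF]) auto
  have intF: "integrable lborel F"
    by (rule integrable_compact_support[OF K contF F0])
  have [measurable]: "F \<in> borel_measurable borel"
    using contF by (rule borel_measurable_continuous_onI)
  have intFt: "integrable lborel (\<lambda>x. F (c + x))" for c
  proof -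
    have "integrable (distr lborel borel ((+) c)) F"
      using intF by (simp add: lborel_distr_plus)
    then show ?thesis
      by (rule integrable_distr[rotated]) auto
  qed
  have intD: "integral\<^sup>L lborel (D n) = 0" for n
    unfolding D_def using intF intFt by (simp add: integral_lborel_translation)
  have D0: "D n x = 0" if "x \<notin> L" for n x
  proof -
    have "x + s *\<^sub>R v \<notin> K" if "s \<in> {0..1}" for s
    proof
      assume "x + s *\<^sub>R v \<in> K"
      then have "(x + s *\<^sub>R v) - s *\<^sub>R v \<in> L" unfolding L_def using that by blast
      then show False using \<open>x \<notin> L\<close> by simp
    qed
    from this[of 0] this[of "1 / real (Suc n)"] show ?thesis
      unfolding D_def by (simp add: F0 add.commute)
  qed
  have Dle: "norm (D n x) \<le> B" for n x
  proof -
    have "norm (D n x) \<le> real (Suc n) * (B * (1 / real (Suc n)))"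
      unfolding D_def norm_scaleR using lip[of "1 / real (Suc n)" x]
      by (intro mult_mono) auto
    then show ?thesis by simp
  qed
  have "(\<lambda>n. integral\<^sup>L lborel (D n)) \<longlonglongrightarrow> integral\<^sup>L lborel (\<lambda>x. F' x v)"
  proof (rule integral_dominated_convergence)
    show "(\<lambda>x. F' x v) \<in> borel_measurable lborel"
      using borel_measurable_continuous_onI[OF cont] by simp
    show "D n \<in> borel_measurable lborel" for n
      using borel_measurable_continuous_onI[OF contD] by simp
    show "integrable lborel (\<lambda>x. indicator L x *\<^sub>R B)"
      using L by (intro borel_integrable_compact) auto
    show "AE x in lborel. norm (D n x) \<le> indicator L x *\<^sub>R B" for n
      using D0 Dle B(1) by (intro AE_I2) (auto simp: indicator_def)
    have "(\<lambda>n. D n x) \<longlonglongrightarrow> F' x v" for x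
    proof -
      have "((\<lambda>s. F (s *\<^sub>R v + x)) has_derivative (\<lambda>h. F' (0 *\<^sub>R v + x) (h *\<^sub>R v))) (at 0)"
        by (rule line_der)
      moreover have "F' x (h *\<^sub>R v) = h *\<^sub>R F' x v" for h
        by (rule linear_cmul[OF has_derivative_linear[OF der]])
      ultimately have "((\<lambda>h. norm (F (h *\<^sub>R v + x) - F x - h *\<^sub>R F' x v) / norm h) \<longlongrightarrow> 0) (at 0)"
        by (simp add: has_derivative_at)
      moreover have "norm (F (h *\<^sub>R v + x) - F x - h *\<^sub>R F' x v) / norm h
          = norm ((F (h *\<^sub>R v + x) - F x) /\<^sub>R h - F' x v)" if "h \<noteq> 0" for h
      proof -
        have "(F (h *\<^sub>R v + x) - F x) /\<^sub>R h - F' x v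
            = (F (h *\<^sub>R v + x) - F x - h *\<^sub>R F' x v) /\<^sub>R h"
          using that by (simp add: scaleR_diff_right)
        then show ?thesis by (simp add: divide_inverse mult.commute)
      qed
      then have "\<forall>\<^sub>F h in at 0. norm (F (h *\<^sub>R v + x) - F x - h *\<^sub>R F' x v) / norm h
          = norm ((F (h *\<^sub>R v + x) - F x) /\<^sub>R h - F' x v)"
        by (simp add: eventually_at_filter)
      ultimately have "((\<lambda>h. norm ((F (h *\<^sub>R v + x) - F x) /\<^sub>R h - F' x v)) \<longlongrightarrow> 0) (at 0)"
        by (rule Lim_transform_eventually)
      then have "((\<lambda>y. (F (y *\<^sub>R v + x) - F x) /\<^sub>R y) \<longlongrightarrow> F' x v) (at 0)"
        by (simp add: tendsto_norm_zero_iff LIM_zero_iff)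
      moreover have "filterlim (\<lambda>n. 1 / real (Suc n)) (at 0) sequentially"
        using LIMSEQ_inverse_real_of_nat by (simp add: filterlim_at inverse_eq_divide)
      ultimately have "(\<lambda>n. (F ((1 / real (Suc n)) *\<^sub>R v + x) - F x) /\<^sub>R (1 / real (Suc n))) \<longlonglongrightarrow> F' x v"
        by (rule filterlim_compose)
      then show ?thesis by (simp add: D_def inverse_eq_divide)
    qed
    then show "AE x in lborel. (\<lambda>n. D n x) \<longlonglongrightarrow> F' x v" by simp
  qed
  then show ?thesis
    by (simp add: intD LIMSEQ_const_iff)
qed

section \<open>Differential calculus and Wirtinger operators on the domain\<close>

lemma open_Dom: "open Dom"
  unfolding Dom_def by (intro open_Times) auto

lemma Dom_borel [measurable]: "Dom \<in> sets borel"
  using open_Dom by simp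

lemma Dom_iff: "(z, w) \<in> Dom \<longleftrightarrow> cmod w < 1"
  by (simp add: Dom_def)

text \<open>Complex values keep products with complex coefficient functions inside the notion;
  continuity is asked one direction at a time, the form in which integration by parts consumes
  it.\<close>

definition C1_with ::
  "(complex \<times> complex \<Rightarrow> complex) \<Rightarrow> (complex \<times> complex \<Rightarrow> complex \<times> complex \<Rightarrow> complex) \<Rightarrow> bool" where
  "C1_with f f' \<longleftrightarrow> (\<forall>x\<in>Dom. (f has_derivative f' x) (at x)) \<and> (\<forall>v. continuous_on Dom (\<lambda>x. f' x v))"

lemma C1_withD:
  assumes "C1_with f f'"
  shows "x \<in> Dom \<Longrightarrow> (f has_derivative f' x) (at x)" and "continuous_on Dom (\<lambda>x. f' x v)"
  using assms unfolding C1_with_def by blast+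

lemma C1_with_continuous: "C1_with f f' \<Longrightarrow> continuous_on Dom f"
  unfolding C1_with_def by (auto intro!: continuous_at_imp_continuous_on dest: has_derivative_continuous)

lemma C1_with_mult:
  assumes "C1_with f f'" and "C1_with g g'"
  shows "C1_with (\<lambda>x. f x * g x) (\<lambda>x h. f x * g' x h + f' x h * g x)"
proof -
  have "((\<lambda>x. f x * g x) has_derivative (\<lambda>h. f x * g' x h + f' x h * g x)) (at x)" if "x \<in> Dom" for x
    by (intro has_derivative_mult C1_withD(1)[OF assms(1) that] C1_withD(1)[OF assms(2) that])
  moreover have "continuous_on Dom (\<lambda>x. f x * g' x v + f' x v * g x)" for v
    by (intro continuous_intros C1_withD(2)[OF assms(1)] C1_withD(2)[OF assms(2)]
        C1_with_continuous[OF assms(1)] C1_with_continuous[OF assms(2)])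
  ultimately show ?thesis unfolding C1_with_def by blast
qed

lemma frechet_derivative_eq:
  "(f has_derivative f') (at x) \<Longrightarrow> frechet_derivative f (at x) = f'"
  by (rule frechet_derivative_at[symmetric])

text \<open>The open sets \<open>D\<close> and \<open>- K\<close> cover the space, and on the second
  one the function is zero.\<close>

lemma continuous_on_UNIV_glue:
  fixes f :: "'a::t2_space \<Rightarrow> 'b::real_normed_vector"
  assumes "continuous_on D f" and "open D" and "compact K" and "K \<subseteq> D" and "\<And>x. x \<notin> K \<Longrightarrow> f x = 0"
  shows "continuous_on UNIV f"
proof -
  have "open (- K)" using assms(3) by (simp add: compact_imp_closed open_Compl)
  moreover have "continuous_on (- K) f"
    using assms(5) by (subst continuous_on_cong[OF refl, of _ _ "\<lambda>_. 0"]) auto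
  moreover have "D \<union> - K = UNIV" using assms(4) by auto
  ultimately show ?thesis
    using continuous_on_open_Un[OF assms(2) _ assms(1), of "- K"] by simp
qed

text \<open>A common form of all four Wirtinger derivatives, so that the product rule and
  integration by parts are proved once: \<open>a\<close> and \<open>b\<close> are the real and
  imaginary directions, and \<open>c\<close> is -i or i.\<close>

definition wirtinger ::
  "complex \<times> complex \<Rightarrow> complex \<times> complex \<Rightarrow> complex \<Rightarrow>
   (complex \<times> complex \<Rightarrow> complex) \<Rightarrow> complex \<times> complex \<Rightarrow> complex" where
  "wirtinger a b c f x = (frechet_derivative f (at x) a + c * frechet_derivative f (at x) b) / 2"

lemma wirtinger_simps:
  "dz = wirtinger (1, 0) (\<i>, 0) (- \<i>)" "dzb = wirtinger (1, 0) (\<i>, 0) \<i>"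
  "dw = wirtinger (0, 1) (0, \<i>) (- \<i>)" "dwb = wirtinger (0, 1) (0, \<i>) \<i>"
  by (auto simp: fun_eq_iff wirtinger_def dz_def dzb_def dw_def dwb_def)

lemma wirtinger_eq:
  "(f has_derivative f') (at x) \<Longrightarrow> wirtinger a b c f x = (f' a + c * f' b) / 2"
  by (simp add: wirtinger_def frechet_derivative_eq)

lemma wirtinger_mult:
  assumes "(f has_derivative f') (at x)" and "(g has_derivative g') (at x)"
  shows "wirtinger a b c (\<lambda>x. f x * g x) x = f x * wirtinger a b c g x + wirtinger a b c f x * g x"
  unfolding wirtinger_eq[OF assms(1)] wirtinger_eq[OF assms(2)]
    wirtinger_eq[OF has_derivative_mult[OF assms]]
  by (simp add: field_simps)

lemma continuous_on_wirtinger: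
  assumes "C1_with f f'"
  shows "continuous_on Dom (wirtinger a b c f)"
proof -
  have "continuous_on Dom (\<lambda>x. (f' x a + c * f' x b) / 2)"
    by (intro continuous_intros C1_withD(2)[OF assms]) auto
  moreover have "wirtinger a b c f x = (f' x a + c * f' x b) / 2" if "x \<in> Dom" for x
    by (rule wirtinger_eq[OF C1_withD(1)[OF assms that]])
  ultimately show ?thesis
    by (metis (no_types, lifting) continuous_on_eq)
qed

lemma set_borel_measurable_continuous_on_Dom:
  fixes f :: "complex \<times> complex \<Rightarrow> 'b::real_normed_vector"
  shows "continuous_on Dom f \<Longrightarrow> set_borel_measurable lborel Dom f"
  unfolding set_borel_measurable_def
  using borel_measurable_continuous_on_indicator[OF Dom_borel] by simp

lemma set_integrable_compact_support:
  fixes F :: "complex \<times> complex \<Rightarrow> complex"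
  assumes "continuous_on Dom F" and "compact K" and "K \<subseteq> Dom" and "\<And>x. x \<notin> K \<Longrightarrow> F x = 0"
  shows "set_integrable lborel Dom F"
proof -
  have "integrable lborel F"
    using continuous_on_UNIV_glue[OF assms(1) open_Dom assms(2-4)] assms(2,4)
    by (intro integrable_compact_support) auto
  then show ?thesis
    unfolding set_integrable_def by (intro integrable_mult_indicator) auto
qed

text \<open>Since \<open>P\<close> has compact support inside the open domain, the product extended
  by zero is differentiable everywhere, however \<open>g\<close> behaves at the boundary; its
  directional derivative then integrates to zero.\<close>

lemma integration_by_parts_Dom:
  assumes K: "compact K" "K \<subseteq> Dom" and P0: "\<And>x. x \<notin> K \<Longrightarrow> P x = 0"
    and P: "\<And>x. (P has_derivative P' x) (at x)" "\<And>v. continuous_on UNIV (\<lambda>x. P' x v)"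
    and g: "C1_with g g'"
  shows "(LINT x:Dom|lborel. g x * P' x v + g' x v * P x) = 0"
proof -
  define F where "F x = (if x \<in> Dom then g x * P x else 0)" for x
  define F' where "F' x h = (if x \<in> Dom then g x * P' x h + g' x h * P x else 0)" for x h
  have F0: "F x = 0" if "x \<notin> K" for x using P0 that by (simp add: F_def)
  have P'0: "P' x v = 0" if "x \<notin> K" for x v
    using fun_cong[OF has_derivative_eq_0_outside[OF K(1) P0 P(1) that]] by simp
  have opK: "open (- K)" using K by (simp add: compact_imp_closed open_Compl)
  have der: "(F has_derivative F' x) (at x)" for x
  proof (cases "x \<in> Dom")
    case True
    have "(g has_derivative g' x) (at x)" by (rule C1_withD(1)[OF g True])
    from has_derivative_mult[OF this P(1)]
    have "((\<lambda>x. g x * P x) has_derivative F' x) (at x)"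
      using True by (simp add: F'_def[abs_def])
    then show ?thesis
      by (rule has_derivative_transform_within_open[OF _ open_Dom True]) (simp add: F_def)
  next
    case False
    then have "x \<in> - K" using K by auto
    have "(F has_derivative (\<lambda>_. 0)) (at x)"
      by (rule has_derivative_transform_within_open[OF has_derivative_const[of 0] opK \<open>x \<in> - K\<close>])
        (simp add: F0)
    then show ?thesis using False by (simp add: F'_def[abs_def])
  qed
  have "continuous_on Dom (\<lambda>x. F' x v)"
  proof -
    have "continuous_on Dom P"
      by (intro continuous_at_imp_continuous_on ballI has_derivative_continuous[OF P(1)])
    then have "continuous_on Dom (\<lambda>x. g x * P' x v + g' x v * P x)"
      by (intro continuous_intros C1_with_continuous[OF g] C1_withD(2)[OF g] continuous_on_subset[OF P(2)]) auto
    then show ?thesis by (simp add: F'_def cong: continuous_on_cong)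
  qed
  moreover have "F' x v = 0" if "x \<notin> K" for x
    using that P0 P'0 by (simp add: F'_def)
  ultimately have "continuous_on UNIV (\<lambda>x. F' x v)"
    using K by (intro continuous_on_UNIV_glue[OF _ open_Dom, of _ K]) auto
  from integral_directional_derivative_eq_0[OF K(1) F0 der this]
  have "integral\<^sup>L lborel (\<lambda>x. F' x v) = 0" .
  moreover have "F' x v = indicator Dom x *\<^sub>R (g x * P' x v + g' x v * P x)" for x
    by (simp add: F'_def indicator_def)
  ultimately show ?thesis
    by (simp add: set_lebesgue_integral_def)
qed

text \<open>A Wirtinger derivative is a complex linear combination, with weights 1/2 and c/2, of two
  directional derivatives, and the identity is linear in the direction.\<close>

lemma wirtinger_by_parts:
  assumes K: "compact K" "K \<subseteq> Dom" and P0: "\<And>x. x \<notin> K \<Longrightarrow> P x = 0"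
    and P: "\<And>x. (P has_derivative P' x) (at x)" "\<And>v. continuous_on UNIV (\<lambda>x. P' x v)"
    and g: "C1_with g g'"
  shows "set_integrable lborel Dom (\<lambda>x. g x * wirtinger a b c P x)"
    and "set_integrable lborel Dom (\<lambda>x. wirtinger a b c g x * P x)"
    and "(LINT x:Dom|lborel. g x * wirtinger a b c P x) = - (LINT x:Dom|lborel. wirtinger a b c g x * P x)"
proof -
  have P'0: "P' x v = 0" if "x \<notin> K" for x v
    using fun_cong[OF has_derivative_eq_0_outside[OF K(1) P0 P(1) that]] by simp
  have wP: "wirtinger a b c P x = (P' x a + c * P' x b) / 2" for x
    by (rule wirtinger_eq[OF P(1)])
  have cP: "continuous_on Dom P"
    by (intro continuous_at_imp_continuous_on ballI has_derivative_continuous[OF P(1)])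
  have cg: "continuous_on Dom g" and cg': "continuous_on Dom (\<lambda>x. g' x v)" for v
    by (rule C1_with_continuous[OF g], rule C1_withD(2)[OF g])
  have cP': "continuous_on Dom (\<lambda>x. P' x v)" for v
    using continuous_on_subset[OF P(2)] by auto
  show i1: "set_integrable lborel Dom (\<lambda>x. g x * wirtinger a b c P x)"
    by (rule set_integrable_compact_support[OF _ K]) (auto simp: wP P'0 intro!: continuous_intros cg cP')
  show i2: "set_integrable lborel Dom (\<lambda>x. wirtinger a b c g x * P x)"
    by (rule set_integrable_compact_support[OF _ K])
      (auto simp: P0 intro!: continuous_intros continuous_on_wirtinger[OF g] cP)
  have i3: "set_integrable lborel Dom (\<lambda>x. g x * P' x v + g' x v * P x)" for v
    by (rule set_integrable_compact_support[OF _ K]) (auto simp: P0 P'0 intro!: continuous_intros cg cg' cP cP')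
  have "(LINT x:Dom|lborel. g x * wirtinger a b c P x + wirtinger a b c g x * P x) =
     (LINT x:Dom|lborel. (1/2) * (g x * P' x a + g' x a * P x) + (c/2) * (g x * P' x b + g' x b * P x))"
  proof (rule set_lebesgue_integral_cong)
    show "\<forall>x. x \<in> Dom \<longrightarrow> g x * wirtinger a b c P x + wirtinger a b c g x * P x =
      (1/2) * (g x * P' x a + g' x a * P x) + (c/2) * (g x * P' x b + g' x b * P x)"
    proof (intro allI impI)
      fix x assume "x \<in> Dom"
      then have wg: "wirtinger a b c g x = (g' x a + c * g' x b) / 2"
        by (intro wirtinger_eq C1_withD(1)[OF g])
      show "g x * wirtinger a b c P x + wirtinger a b c g x * P x =
      (1/2) * (g x * P' x a + g' x a * P x) + (c/2) * (g x * P' x b + g' x b * P x)"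
        by (simp add: wP wg field_simps)
    qed
  qed simp
  also have "\<dots> = (LINT x:Dom|lborel. (1/2) * (g x * P' x a + g' x a * P x))
      + (LINT x:Dom|lborel. (c/2) * (g x * P' x b + g' x b * P x))"
    by (rule set_integral_add(2)) (intro set_integrable_mult_right i3)+
  also have "\<dots> = 0"
    using integration_by_parts_Dom[OF K P0 P g] by (simp only: set_integral_mult_right) simp
  finally show "(LINT x:Dom|lborel. g x * wirtinger a b c P x) = - (LINT x:Dom|lborel. wirtinger a b c g x * P x)"
    using set_integral_add(2)[OF i1 i2] by (simp add: eq_neg_iff_add_eq_0)
qed

text \<open>A form of the fundamental lemma of the calculus of variations. It asks only for one
  nonnegative bump per ball, positive at the centre, because cut-offs of a special product shape are
  the only test functions available later.\<close>

lemma eq_0_of_localized_integrals: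
  assumes E: "continuous_on Dom E" and x0: "x0 \<in> Dom"
    and bump: "\<And>d. d > 0 \<Longrightarrow> cball x0 d \<subseteq> Dom \<Longrightarrow> \<exists>P :: complex \<times> complex \<Rightarrow> real.
      continuous_on UNIV P \<and> (\<forall>x. 0 \<le> P x) \<and> P x0 > 0 \<and> (\<forall>x. x \<notin> cball x0 d \<longrightarrow> P x = 0) \<and>
      (LINT x:Dom|lborel. of_real (P x) * E x) = 0"
  shows "E x0 = (0::complex)"
proof (rule ccontr)
  assume ne: "E x0 \<noteq> 0"
  \<comment> \<open>Rotating by \<open>cnj (E x0)\<close> turns the complex value at
    \<open>x0\<close> into a positive real one, so positivity persists nearby and the integrand
    against a bump has a sign.\<close>
  define e where "e x = Re (cnj (E x0) * E x)" for x
  have e: "continuous_on Dom e" unfolding e_def by (intro continuous_intros E)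
  have e0: "e x0 > 0"
  proof -
    have "e x0 = (cmod (E x0))\<^sup>2"
      unfolding e_def cmod_power2 by (simp add: power2_eq_square)
    then show ?thesis using ne by simp
  qed
  obtain d1 where d1: "d1 > 0" "cball x0 d1 \<subseteq> Dom"
    using open_contains_cball open_Dom x0 by blast
  have "isCont e x0" using e open_Dom x0 by (simp add: continuous_on_eq_continuous_at)
  then obtain d2 where d2: "d2 > 0" "\<And>x. dist x x0 < d2 \<Longrightarrow> dist (e x) (e x0) < e x0"
    using e0 unfolding continuous_at_eps_delta dist_norm by blast
  define d where "d = min d1 (d2 / 2)"
  have d: "d > 0" "cball x0 d \<subseteq> Dom" "\<And>x. x \<in> cball x0 d \<Longrightarrow> e x > 0"
  proof -
    show "d > 0" using d1 d2 by (simp add: d_def)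
    show "cball x0 d \<subseteq> Dom" using d1 by (auto simp: d_def)
    fix x assume "x \<in> cball x0 d"
    then have "dist x x0 < d2" using d2(1) by (auto simp: d_def dist_commute)
    from d2(2)[OF this] show "e x > 0" by (auto simp: dist_real_def)
  qed
  from bump[OF d(1,2)] obtain P :: "complex \<times> complex \<Rightarrow> real" where
    P: "continuous_on UNIV P" "\<And>x. 0 \<le> P x" "P x0 > 0" "\<And>x. x \<notin> cball x0 d \<Longrightarrow> P x = 0"
      "(LINT x:Dom|lborel. of_real (P x) * E x) = 0" by blast
  have cP: "continuous_on A P" for A using P(1) continuous_on_subset by blast
  define h where "h x = P x * e x" for x
  have "continuous_on Dom h" unfolding h_def by (intro continuous_intros cP e)
  then have ch: "continuous_on UNIV h"
    by (rule continuous_on_UNIV_glue[OF _ open_Dom compact_cball d(2)]) (simp add: h_def P(4))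
  have ih: "integrable lborel h"
    by (rule integrable_compact_support[OF compact_cball[of x0 d] ch]) (simp add: h_def P(4))
  have h_nonneg: "h x \<ge> 0" for x
    using d(3)[of x] P(2)[of x] P(4)[of x] by (cases "x \<in> cball x0 d") (auto simp: h_def less_imp_le)
  have iE: "set_integrable lborel Dom (\<lambda>x. of_real (P x) * E x)"
    by (rule set_integrable_compact_support[OF _ compact_cball d(2)])
      (auto simp: P(4) intro!: continuous_intros cP E)
  have "integral\<^sup>L lborel h = Re (cnj (E x0) * (LINT x:Dom|lborel. of_real (P x) * E x))"
  proof -
    have "cnj (E x0) * (LINT x:Dom|lborel. of_real (P x) * E x)
        = (LINT x|lborel. cnj (E x0) * (indicator Dom x *\<^sub>R (of_real (P x) * E x)))"
      unfolding set_lebesgue_integral_def by (rule integral_mult_right_zero[symmetric])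
    also have "Re \<dots> = (LINT x|lborel. Re (cnj (E x0) * (indicator Dom x *\<^sub>R (of_real (P x) * E x))))"
      using iE unfolding set_integrable_def by (intro integral_Re[symmetric] integrable_mult_right)
    also have "\<dots> = integral\<^sup>L lborel h"
    proof (rule Bochner_Integration.integral_cong)
      fix x
      show "Re (cnj (E x0) * (indicator Dom x *\<^sub>R (of_real (P x) * E x))) = h x"
        using d(2) P(4)[of x] by (cases "x \<in> Dom"; cases "x \<in> cball x0 d") (auto simp: h_def e_def algebra_simps)
    qed simp
    finally show ?thesis by simp
  qed
  then have "integral\<^sup>L lborel h = 0" by (simp add: P(5))
  then have "AE x in lborel. h x = 0"
    using integral_nonneg_eq_0_iff_AE[OF ih] h_nonneg by simp
  then have "h x0 = 0"
  proof -
    assume ae: "AE x in lborel. h x = 0"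
    \<comment> \<open>A continuous function vanishing almost everywhere vanishes: its nonzero set is
      open and null, hence empty.\<close>
    have "open {x. h x \<noteq> 0}"
    proof -
      have "{x. h x \<noteq> 0} = h -` (- {0})" by auto
      then show ?thesis using ch by (simp add: continuous_on_open_vimage open_Compl)
    qed
    moreover have "negligible {x. h x \<noteq> 0}"
      using ae ch borel_measurable_continuous_onI[OF ch]
      by (auto simp: negligible_iff_null_sets AE_iff_null intro!: null_sets_completionI)
    ultimately show ?thesis
      using open_not_negligible by blast
  qed
  moreover have "h x0 > 0" using P(3) e0 by (simp add: h_def)
  ultimately show False by simp
qed

section \<open>Extending a weak equation from polynomials to test functions\<close>

text \<open>Growth slower than every Gaussian in z. Quantifying over all rates \<open>e\<close>
  makes the class closed under products, which a fixed rate would not; w needs no control because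
  the disc is bounded.\<close>

definition tame :: "(complex \<times> complex \<Rightarrow> complex) \<Rightarrow> bool" where
  "tame P \<longleftrightarrow> continuous_on Dom P \<and>
     (\<forall>e>0. \<exists>C\<ge>0. \<forall>x\<in>Dom. cmod (P x) \<le> C * exp (e * (cmod (fst x))\<^sup>2))"

lemma tameE:
  assumes "tame P" and "e > 0"
  obtains C where "C \<ge> 0" and "\<And>x. x \<in> Dom \<Longrightarrow> cmod (P x) \<le> C * exp (e * (cmod (fst x))\<^sup>2)"
  using assms unfolding tame_def by blast

lemma tame_continuous: "tame P \<Longrightarrow> continuous_on Dom P"
  by (simp add: tame_def)

lemma tame_bounded:
  assumes "continuous_on Dom P" and "\<And>x. x \<in> Dom \<Longrightarrow> cmod (P x) \<le> C"
  shows "tame P"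
  unfolding tame_def
proof (intro conjI allI impI exI[of _ "max C 0"] ballI)
  fix e :: real and x :: "complex \<times> complex" assume "e > 0" "x \<in> Dom"
  have "cmod (P x) \<le> max C 0 * 1" using assms(2)[OF \<open>x \<in> Dom\<close>] by simp
  also have "\<dots> \<le> max C 0 * exp (e * (cmod (fst x))\<^sup>2)"
    using \<open>e > 0\<close> by (intro mult_left_mono) auto
  finally show "cmod (P x) \<le> max C 0 * exp (e * (cmod (fst x))\<^sup>2)" .
qed (use assms in auto)

lemma tame_const [simp]: "tame (\<lambda>_. c)"
  by (rule tame_bounded[of _ "cmod c"]) auto

lemma tame_snd: "tame snd"
  by (rule tame_bounded[of _ 1]) (auto simp: Dom_iff intro!: continuous_intros)

lemma tame_fst: "tame fst"
  unfolding tame_def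
proof (intro conjI allI impI)
  fix e :: real assume e: "e > 0"
  show "\<exists>C\<ge>0. \<forall>x\<in>Dom. cmod (fst x) \<le> C * exp (e * (cmod (fst x))\<^sup>2)"
  \<comment> \<open>The constant comes from (1 + 1/e)(1 + e t^2) = 1 + t^2 + 1/e + e t^2, which
    dominates 1 + t^2 and hence t.\<close>
  proof (intro exI[of _ "1 + 1 / e"] conjI ballI)
    fix x :: "complex \<times> complex"
    define t where "t = cmod (fst x)"
    have "t \<le> 1 + t\<^sup>2"
      using zero_le_power2[of "t - 1 / 2"] by (simp add: power2_eq_square algebra_simps)
    also have "\<dots> \<le> (1 + 1 / e) * (1 + e * t\<^sup>2)"
      using e by (simp add: field_simps)
    also have "\<dots> \<le> (1 + 1 / e) * exp (e * t\<^sup>2)"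
      using e by (intro mult_left_mono exp_ge_add_one_self) auto
    finally show "cmod (fst x) \<le> (1 + 1 / e) * exp (e * (cmod (fst x))\<^sup>2)"
      unfolding t_def .
  qed (use e in auto)
qed (auto intro!: continuous_intros)

lemma tame_cnj: "tame P \<Longrightarrow> tame (\<lambda>x. cnj (P x))"
  unfolding tame_def by (auto intro!: continuous_intros)

lemma tame_add:
  assumes "tame P" and "tame Q"
  shows "tame (\<lambda>x. P x + Q x)"
  unfolding tame_def
proof (intro conjI allI impI)
  fix e :: real assume "e > 0"
  obtain C where C: "C \<ge> 0" "\<And>x. x \<in> Dom \<Longrightarrow> cmod (P x) \<le> C * exp (e * (cmod (fst x))\<^sup>2)"
    using tameE[OF assms(1) \<open>e > 0\<close>] by blast
  obtain D where D: "D \<ge> 0" "\<And>x. x \<in> Dom \<Longrightarrow> cmod (Q x) \<le> D * exp (e * (cmod (fst x))\<^sup>2)"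
    using tameE[OF assms(2) \<open>e > 0\<close>] by blast
  have "cmod (P x + Q x) \<le> (C + D) * exp (e * (cmod (fst x))\<^sup>2)" if "x \<in> Dom" for x
    using norm_triangle_ineq[of "P x" "Q x"] C(2)[OF that] D(2)[OF that] by (simp add: distrib_right)
  then show "\<exists>C\<ge>0. \<forall>x\<in>Dom. cmod (P x + Q x) \<le> C * exp (e * (cmod (fst x))\<^sup>2)"
    using C(1) D(1) by (intro exI[of _ "C + D"]) auto
qed (intro continuous_intros tame_continuous assms)

text \<open>Each factor is given half of the rate \<open>e\<close>, and the exponentials
  multiply.\<close>

lemma tame_mult:
  assumes "tame P" and "tame Q"
  shows "tame (\<lambda>x. P x * Q x)"
  unfolding tame_def
proof (intro conjI allI impI)
  fix e :: real assume "e > 0"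
  then have e2: "e / 2 > 0" by simp
  obtain C where C: "C \<ge> 0" "\<And>x. x \<in> Dom \<Longrightarrow> cmod (P x) \<le> C * exp (e / 2 * (cmod (fst x))\<^sup>2)"
    using tameE[OF assms(1) e2] by blast
  obtain D where D: "D \<ge> 0" "\<And>x. x \<in> Dom \<Longrightarrow> cmod (Q x) \<le> D * exp (e / 2 * (cmod (fst x))\<^sup>2)"
    using tameE[OF assms(2) e2] by blast
  have "cmod (P x * Q x) \<le> (C * D) * exp (e * (cmod (fst x))\<^sup>2)" if "x \<in> Dom" for x
  proof -
    have "cmod (P x * Q x) \<le> (C * exp (e / 2 * (cmod (fst x))\<^sup>2)) * (D * exp (e / 2 * (cmod (fst x))\<^sup>2))"
      unfolding norm_mult using C D that by (intro mult_mono) auto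
    also have "\<dots> = (C * D) * (exp (e / 2 * (cmod (fst x))\<^sup>2) * exp (e / 2 * (cmod (fst x))\<^sup>2))"
      by (simp add: algebra_simps)
    also have "exp (e / 2 * (cmod (fst x))\<^sup>2) * exp (e / 2 * (cmod (fst x))\<^sup>2) = exp (e * (cmod (fst x))\<^sup>2)"
      by (simp add: exp_add[symmetric])
    finally show ?thesis .
  qed
  then show "\<exists>C\<ge>0. \<forall>x\<in>Dom. cmod (P x * Q x) \<le> C * exp (e * (cmod (fst x))\<^sup>2)"
    using C(1) D(1) by (intro exI[of _ "C * D"]) auto
qed (intro continuous_intros tame_continuous assms)

lemma tame_minus: "tame P \<Longrightarrow> tame (\<lambda>x. - P x)"
  unfolding tame_def by (auto intro!: continuous_intros)

lemma tame_diff: "tame P \<Longrightarrow> tame Q \<Longrightarrow> tame (\<lambda>x. P x - Q x)"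
  using tame_add[of P "\<lambda>x. - Q x"] tame_minus[of Q] by simp

lemma tame_power: "tame P \<Longrightarrow> tame (\<lambda>x. P x ^ n)"
  by (induction n) (auto intro: tame_mult)

lemma tame_sum: "(\<And>i. i \<in> I \<Longrightarrow> tame (f i)) \<Longrightarrow> tame (\<lambda>x. \<Sum>i\<in>I. f i x)"
  by (induction I rule: infinite_finite_induct) (auto intro: tame_add)

lemmas tame_intros = tame_const tame_fst tame_snd tame_cnj tame_add tame_mult tame_minus tame_diff
  tame_power tame_sum

lemma tame_set_integrable:
  fixes \<rho> :: "complex \<times> complex \<Rightarrow> real"
  assumes cont: "continuous_on Dom \<rho>"
    and gauss: "set_integrable lborel Dom (\<lambda>x. exp ((cmod (fst x))\<^sup>2 / 4) * \<rho> x)"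
    and P: "tame P"
  shows "set_integrable lborel Dom (\<lambda>x. P x * of_real (\<rho> x))"
proof -
  obtain C where C: "C \<ge> 0" "\<And>x. x \<in> Dom \<Longrightarrow> cmod (P x) \<le> C * exp (1/4 * (cmod (fst x))\<^sup>2)"
    using tameE[OF P, of "1/4"] by auto
  show ?thesis
  proof (rule set_integrable_bound)
    show "set_integrable lborel Dom (\<lambda>x. C * (exp ((cmod (fst x))\<^sup>2 / 4) * \<rho> x))"
      using gauss by (intro set_integrable_mult_right) auto
    show "set_borel_measurable lborel Dom (\<lambda>x. P x * complex_of_real (\<rho> x))"
      by (intro set_borel_measurable_continuous_on_Dom continuous_intros cont tame_continuous P)
    show "AE x in lborel. x \<in> Dom \<longrightarrow> cmod (P x * complex_of_real (\<rho> x)) \<le> norm (C * (exp ((cmod (fst x))\<^sup>2 / 4) * \<rho> x))"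
      using mult_right_mono[OF C(2) abs_ge_zero] C(1) by (auto simp: norm_mult abs_mult mult.assoc)
  qed
qed

section \<open>Weak equations and the algebra of multipliers\<close>

definition mon :: "nat \<Rightarrow> nat \<Rightarrow> nat \<Rightarrow> nat \<Rightarrow> complex \<times> complex \<Rightarrow> complex" where
  "mon a b c d x = fst x ^ a * cnj (fst x) ^ b * snd x ^ c * cnj (snd x) ^ d"

lemma tame_mon: "tame (mon a b c d)"
  unfolding mon_def[abs_def] by (intro tame_intros)

definition mon_deriv ::
  "(complex \<times> complex \<Rightarrow> complex) \<Rightarrow> (complex \<times> complex \<Rightarrow> complex) \<Rightarrow>
   (complex \<times> complex \<Rightarrow> complex) \<Rightarrow> (complex \<times> complex \<Rightarrow> complex) \<Rightarrow>
   nat \<Rightarrow> nat \<Rightarrow> nat \<Rightarrow> nat \<Rightarrow> complex \<times> complex \<Rightarrow> complex" where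
  "mon_deriv \<xi>1 \<xi>2 \<xi>3 \<xi>4 a b c d x =
       \<xi>1 x * (of_nat a * fst x ^ (a - 1)) * cnj (fst x) ^ b * snd x ^ c * cnj (snd x) ^ d
     + \<xi>2 x * fst x ^ a * (of_nat b * cnj (fst x) ^ (b - 1)) * snd x ^ c * cnj (snd x) ^ d
     + \<xi>3 x * fst x ^ a * cnj (fst x) ^ b * (of_nat c * snd x ^ (c - 1)) * cnj (snd x) ^ d
     + \<xi>4 x * fst x ^ a * cnj (fst x) ^ b * snd x ^ c * (of_nat d * cnj (snd x) ^ (d - 1))"

text \<open>The weak form of a first order equation: \<open>\<xi>1\<close>, \<open>\<xi>2\<close>, \<open>\<xi>3\<close>, \<open>\<xi>4\<close> are the components of a
  complex vector field \<open>X\<close> along the derivatives in \<open>z\<close>, \<open>cnj z\<close>, \<open>w\<close>, \<open>cnj w\<close>, and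
  \<open>mon_deriv\<close> is \<open>X\<close> applied to a monomial.\<close>

locale weak_equation =
  fixes \<rho> :: "complex \<times> complex \<Rightarrow> real" and \<xi>1 \<xi>2 \<xi>3 \<xi>4 q :: "complex \<times> complex \<Rightarrow> complex"
  assumes cont_rho: "continuous_on Dom \<rho>"
    and gauss: "set_integrable lborel Dom (\<lambda>x. exp ((cmod (fst x))\<^sup>2 / 4) * \<rho> x)"
    and tame_xi: "tame \<xi>1" "tame \<xi>2" "tame \<xi>3" "tame \<xi>4" and tame_q: "tame q"
    and weak_mon: "\<And>a b c d. (LINT x:Dom|lborel. (mon_deriv \<xi>1 \<xi>2 \<xi>3 \<xi>4 a b c d x - q x * mon a b c d x) * of_real (\<rho> x)) = 0"
begin

abbreviation "dmon \<equiv> mon_deriv \<xi>1 \<xi>2 \<xi>3 \<xi>4"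

lemma tame_dmon: "tame (dmon a b c d)"
  unfolding mon_deriv_def[abs_def] by (intro tame_intros tame_xi)

lemma integrable_tame: "tame P \<Longrightarrow> set_integrable lborel Dom (\<lambda>x. P x * of_real (\<rho> x))"
  by (rule tame_set_integrable[OF cont_rho gauss])

text \<open>\<open>weak P R\<close> says that the weak equation holds for all products of \<open>P\<close> with a
  monomial, \<open>R\<close> playing the role of \<open>X P\<close>; \<open>multiplier S S'\<close> says that multiplication by \<open>S\<close>,
  with \<open>S'\<close> playing the role of \<open>X S\<close>, preserves this.\<close>

definition weak :: "(complex \<times> complex \<Rightarrow> complex) \<Rightarrow> (complex \<times> complex \<Rightarrow> complex) \<Rightarrow> bool" where
  "weak P R \<longleftrightarrow> tame P \<and> tame R \<and>
     (\<forall>a b c d. (LINT x:Dom|lborel.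
        (R x * mon a b c d x + P x * dmon a b c d x - q x * P x * mon a b c d x) * of_real (\<rho> x)) = 0)"

definition multiplier :: "(complex \<times> complex \<Rightarrow> complex) \<Rightarrow> (complex \<times> complex \<Rightarrow> complex) \<Rightarrow> bool" where
  "multiplier S S' \<longleftrightarrow> tame S \<and> tame S' \<and>
     (\<forall>P R. weak P R \<longrightarrow> weak (\<lambda>x. P x * S x) (\<lambda>x. R x * S x + P x * S' x))"

lemma weak_tame: assumes "weak P R" shows "tame P" "tame R"
  using assms by (simp_all add: weak_def)

lemma multiplier_tame: assumes "multiplier S S'" shows "tame S" "tame S'"
  using assms by (simp_all add: multiplier_def)

lemma weak_one: "weak (\<lambda>_. 1) (\<lambda>_. 0)"
  using weak_mon by (simp add: weak_def)

lemma weak_add: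
  assumes "weak P R" and "weak P' R'"
  shows "weak (\<lambda>x. P x + P' x) (\<lambda>x. R x + R' x)"
  unfolding weak_def
proof (intro conjI allI)
  fix a b c d
  let ?I = "\<lambda>P R x. (R x * mon a b c d x + P x * dmon a b c d x - q x * P x * mon a b c d x) * complex_of_real (\<rho> x)"
  have i: "set_integrable lborel Dom (?I P R)" if "tame P" "tame R" for P R
    using that by (intro integrable_tame tame_intros tame_q tame_mon tame_dmon)
  have "(LINT x:Dom|lborel. ?I (\<lambda>x. P x + P' x) (\<lambda>x. R x + R' x) x) = (LINT x:Dom|lborel. ?I P R x + ?I P' R' x)"
    by (intro arg_cong[of _ _ "set_lebesgue_integral lborel Dom"] ext) (simp add: algebra_simps)
  also have "\<dots> = 0"
    using assms by (subst set_integral_add(2)[OF i i]) (auto simp: weak_def)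
  finally show "(LINT x:Dom|lborel. ?I (\<lambda>x. P x + P' x) (\<lambda>x. R x + R' x) x) = 0" .
qed (use assms in \<open>auto simp: weak_def intro: tame_add\<close>)

lemma multiplier_const: "multiplier (\<lambda>_. k) (\<lambda>_. 0)"
  unfolding multiplier_def
proof (intro conjI allI impI)
  fix P R assume W: "weak P R"
  show "weak (\<lambda>x. P x * k) (\<lambda>x. R x * k + P x * 0)"
    unfolding weak_def
  proof (intro conjI allI)
    fix a b c d
    let ?I = "\<lambda>P R x. (R x * mon a b c d x + P x * dmon a b c d x - q x * P x * mon a b c d x) * complex_of_real (\<rho> x)"
    have "(LINT x:Dom|lborel. ?I (\<lambda>x. P x * k) (\<lambda>x. R x * k + P x * 0) x) = (LINT x:Dom|lborel. k * ?I P R x)"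
      by (intro arg_cong[of _ _ "set_lebesgue_integral lborel Dom"] ext) (simp add: algebra_simps)
    also have "\<dots> = k * (LINT x:Dom|lborel. ?I P R x)"
      by (rule set_integral_mult_right)
    also have "\<dots> = 0" using W by (simp add: weak_def)
    finally show "(LINT x:Dom|lborel. ?I (\<lambda>x. P x * k) (\<lambda>x. R x * k + P x * 0) x) = 0" .
  qed (intro tame_intros weak_tame[OF W])+
qed auto

lemma multiplier_add:
  assumes "multiplier S S'" and "multiplier U U'"
  shows "multiplier (\<lambda>x. S x + U x) (\<lambda>x. S' x + U' x)"
  unfolding multiplier_def
proof (intro conjI allI impI)
  fix P R assume W: "weak P R"
  have "weak (\<lambda>x. P x * S x + P x * U x) (\<lambda>x. (R x * S x + P x * S' x) + (R x * U x + P x * U' x))"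
    using assms W unfolding multiplier_def by (intro weak_add) auto
  then show "weak (\<lambda>x. P x * (S x + U x)) (\<lambda>x. R x * (S x + U x) + P x * (S' x + U' x))"
    by (simp add: algebra_simps)
qed (intro tame_intros multiplier_tame[OF assms(1)] multiplier_tame[OF assms(2)])+

text \<open>Two implications are composed. Because \<open>multiplier\<close> speaks about all weak
  pairs, the output of the first is an admissible input of the second, and the product rule appears
  by collecting terms.\<close>

lemma multiplier_mult:
  assumes "multiplier S S'" and "multiplier U U'"
  shows "multiplier (\<lambda>x. S x * U x) (\<lambda>x. S' x * U x + S x * U' x)"
  unfolding multiplier_def
proof (intro conjI allI impI)
  fix P R assume "weak P R"
  then have "weak (\<lambda>x. P x * S x) (\<lambda>x. R x * S x + P x * S' x)"
    using assms(1) unfolding multiplier_def by blast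
  then have "weak (\<lambda>x. P x * S x * U x) (\<lambda>x. (R x * S x + P x * S' x) * U x + P x * S x * U' x)"
    using assms(2) unfolding multiplier_def by blast
  then show "weak (\<lambda>x. P x * (S x * U x)) (\<lambda>x. R x * (S x * U x) + P x * (S' x * U x + S x * U' x))"
    by (simp add: algebra_simps)
qed (intro tame_intros multiplier_tame[OF assms(1)] multiplier_tame[OF assms(2)])+

text \<open>Multiplication by a coordinate merely raises one exponent, so the weak equation for
  \<open>P * S\<close> at one monomial is that for \<open>P\<close> at the next monomial. This is
  why \<open>weak\<close> carries all monomials along.\<close>

lemma multiplier_generator:
  assumes tame: "tame S" "tame S'"
    and step: "\<And>a b c d. \<exists>a' b' c' d'. \<forall>x. mon a' b' c' d' x = S x * mon a b c d x \<and>
      dmon a' b' c' d' x = S' x * mon a b c d x + S x * dmon a b c d x"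
  shows "multiplier S S'"
  unfolding multiplier_def
proof (intro conjI allI impI)
  fix P R assume W: "weak P R"
  show "weak (\<lambda>x. P x * S x) (\<lambda>x. R x * S x + P x * S' x)"
    unfolding weak_def
  proof (intro conjI allI)
    fix a b c d
    obtain a' b' c' d' where s: "\<And>x. mon a' b' c' d' x = S x * mon a b c d x"
      "\<And>x. dmon a' b' c' d' x = S' x * mon a b c d x + S x * dmon a b c d x"
      using step by blast
    have "(LINT x:Dom|lborel. ((R x * S x + P x * S' x) * mon a b c d x + P x * S x * dmon a b c d x
        - q x * (P x * S x) * mon a b c d x) * complex_of_real (\<rho> x))
      = (LINT x:Dom|lborel. (R x * mon a' b' c' d' x + P x * dmon a' b' c' d' x
        - q x * P x * mon a' b' c' d' x) * complex_of_real (\<rho> x))"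
      by (intro arg_cong[of _ _ "set_lebesgue_integral lborel Dom"] ext) (simp add: s algebra_simps)
    then show "(LINT x:Dom|lborel. ((R x * S x + P x * S' x) * mon a b c d x + P x * S x * dmon a b c d x
        - q x * (P x * S x) * mon a b c d x) * complex_of_real (\<rho> x)) = 0"
      using W by (simp add: weak_def)
  qed (intro tame_intros weak_tame[OF W] tame)+
qed (use tame in auto)

text \<open>The product rule for t * t^n, in a form that includes n = 0: the truncated exponent
  \<open>n - 1\<close> is then harmless because of the factor 0.\<close>

lemma of_nat_power_pred_Suc: "of_nat (Suc n) * (t::complex) ^ (Suc n - 1) = t ^ n + t * (of_nat n * t ^ (n - 1))"
  by (cases n) (auto simp: algebra_simps)

lemma multiplier_fst: "multiplier fst \<xi>1"
proof (rule multiplier_generator)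
  fix a b c d
  show "\<exists>a' b' c' d'. \<forall>x. mon a' b' c' d' x = fst x * mon a b c d x \<and>
      dmon a' b' c' d' x = \<xi>1 x * mon a b c d x + fst x * dmon a b c d x"
    by (rule exI[of _ "Suc a"], rule exI[of _ b], rule exI[of _ c], rule exI[of _ d])
      (simp only: mon_def mon_deriv_def of_nat_power_pred_Suc, simp add: algebra_simps)
qed (intro tame_intros tame_xi)+

lemma multiplier_cnj_fst: "multiplier (\<lambda>x. cnj (fst x)) \<xi>2"
proof (rule multiplier_generator)
  fix a b c d
  show "\<exists>a' b' c' d'. \<forall>x. mon a' b' c' d' x = cnj (fst x) * mon a b c d x \<and>
      dmon a' b' c' d' x = \<xi>2 x * mon a b c d x + cnj (fst x) * dmon a b c d x"
    by (rule exI[of _ a], rule exI[of _ "Suc b"], rule exI[of _ c], rule exI[of _ d])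
      (simp only: mon_def mon_deriv_def of_nat_power_pred_Suc, simp add: algebra_simps)
qed (intro tame_intros tame_xi)+

lemma multiplier_snd: "multiplier snd \<xi>3"
proof (rule multiplier_generator)
  fix a b c d
  show "\<exists>a' b' c' d'. \<forall>x. mon a' b' c' d' x = snd x * mon a b c d x \<and>
      dmon a' b' c' d' x = \<xi>3 x * mon a b c d x + snd x * dmon a b c d x"
    by (rule exI[of _ a], rule exI[of _ b], rule exI[of _ "Suc c"], rule exI[of _ d])
      (simp only: mon_def mon_deriv_def of_nat_power_pred_Suc, simp add: algebra_simps)
qed (intro tame_intros tame_xi)+

lemma multiplier_cnj_snd: "multiplier (\<lambda>x. cnj (snd x)) \<xi>4"
proof (rule multiplier_generator)
  fix a b c d
  show "\<exists>a' b' c' d'. \<forall>x. mon a' b' c' d' x = cnj (snd x) * mon a b c d x \<and>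
      dmon a' b' c' d' x = \<xi>4 x * mon a b c d x + cnj (snd x) * dmon a b c d x"
    by (rule exI[of _ a], rule exI[of _ b], rule exI[of _ c], rule exI[of _ "Suc d"])
      (simp only: mon_def mon_deriv_def of_nat_power_pred_Suc, simp add: algebra_simps)
qed (intro tame_intros tame_xi)+

lemma multiplier_power:
  assumes "multiplier S S'"
  shows "multiplier (\<lambda>x. S x ^ n) (\<lambda>x. (of_nat n * S x ^ (n - 1)) * S' x)"
proof (induction n)
  case 0
  then show ?case using multiplier_const[of 1] by simp
next
  case (Suc n)
  have "(of_nat (Suc n) * S x ^ (Suc n - 1)) * S' x
      = S' x * S x ^ n + S x * ((of_nat n * S x ^ (n - 1)) * S' x)" for x
    unfolding of_nat_power_pred_Suc by (simp add: algebra_simps)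
  with multiplier_mult[OF assms Suc] show ?case by (simp only: power_Suc)
qed

lemma multiplier_cmult:
  assumes "multiplier S S'"
  shows "multiplier (\<lambda>x. k * S x) (\<lambda>x. k * S' x)"
  using multiplier_mult[OF multiplier_const[of k] assms] by simp

lemma multiplier_sum:
  fixes n :: nat
  assumes "\<And>i. multiplier (S i) (S' i)"
  shows "multiplier (\<lambda>x. \<Sum>i\<le>n. S i x) (\<lambda>x. \<Sum>i\<le>n. S' i x)"
  by (induction n) (auto intro: assms multiplier_add)

lemma multiplier_poly:
  fixes n :: nat
  assumes "multiplier S S'"
  shows "multiplier (\<lambda>x. \<Sum>i\<le>n. k i * S x ^ i) (\<lambda>x. (\<Sum>i\<le>n. k i * (of_nat i * S x ^ (i - 1))) * S' x)"
  unfolding sum_distrib_right mult.assoc[of "k i" for i]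
  by (intro multiplier_sum multiplier_cmult multiplier_power assms)

text \<open>Dominated convergence. The approximants may use the rate 1/8 because the factors that
  they multiply are \<open>tame\<close> and can be bounded with the rate 1/8 as well, which together
  gives the integrable rate 1/4.\<close>

lemma multiplier_limit:
  assumes M: "\<And>n. multiplier (Sn n) (Sn' n)" and S: "tame S" "tame S'"
    and lim: "\<And>x. x \<in> Dom \<Longrightarrow> (\<lambda>n. Sn n x) \<longlonglongrightarrow> S x" "\<And>x. x \<in> Dom \<Longrightarrow> (\<lambda>n. Sn' n x) \<longlonglongrightarrow> S' x"
    and bound: "\<And>n x. x \<in> Dom \<Longrightarrow> cmod (Sn n x) \<le> C * exp ((cmod (fst x))\<^sup>2 / 8)"
      "\<And>n x. x \<in> Dom \<Longrightarrow> cmod (Sn' n x) \<le> C * exp ((cmod (fst x))\<^sup>2 / 8)"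
  shows "multiplier S S'"
  unfolding multiplier_def
proof (intro conjI allI impI)
  fix P R assume W: "weak P R"
  show "weak (\<lambda>x. P x * S x) (\<lambda>x. R x * S x + P x * S' x)"
    unfolding weak_def
  proof (intro conjI allI)
    fix a b c d
    \<comment> \<open>The integrand is regrouped as a linear expression in the pair (S, S') with
      fixed tame coefficients \<open>A\<close> and \<open>B\<close>, so that pointwise limits and
      bounds pass through it directly.\<close>
    define A where "A x = R x * mon a b c d x + P x * dmon a b c d x - q x * P x * mon a b c d x" for x
    define B where "B x = P x * mon a b c d x" for x
    have tA: "tame A" and tB: "tame B"
      unfolding A_def[abs_def] B_def[abs_def]
      by (intro tame_intros weak_tame[OF W] tame_mon tame_dmon tame_q)+
    define I where "I S S' x = (S x * A x + S' x * B x) * complex_of_real (\<rho> x)" for S S' x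
    have I: "((R x * S x + P x * S' x) * mon a b c d x + P x * S x * dmon a b c d x
        - q x * (P x * S x) * mon a b c d x) * complex_of_real (\<rho> x) = I S S' x" for S S' x
      by (simp add: I_def A_def B_def algebra_simps)
    have I0: "(LINT x:Dom|lborel. I (Sn n) (Sn' n) x) = 0" for n
    proof -
      have "weak (\<lambda>x. P x * Sn n x) (\<lambda>x. R x * Sn n x + P x * Sn' n x)"
        using M[of n] W unfolding multiplier_def by blast
      then have "(LINT x:Dom|lborel. ((R x * Sn n x + P x * Sn' n x) * mon a b c d x + P x * Sn n x * dmon a b c d x
        - q x * (P x * Sn n x) * mon a b c d x) * complex_of_real (\<rho> x)) = 0"
        unfolding weak_def by blast
      then show ?thesis by (simp only: I)
    qed
    obtain C1 where C1: "C1 \<ge> 0" "\<And>x. x \<in> Dom \<Longrightarrow> cmod (A x) \<le> C1 * exp (1/8 * (cmod (fst x))\<^sup>2)"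
      using tameE[OF tA, of "1/8"] by auto
    obtain C2 where C2: "C2 \<ge> 0" "\<And>x. x \<in> Dom \<Longrightarrow> cmod (B x) \<le> C2 * exp (1/8 * (cmod (fst x))\<^sup>2)"
      using tameE[OF tB, of "1/8"] by auto
    have C0: "C \<ge> 0"
    proof -
      have "(0, 0) \<in> Dom" by (simp add: Dom_iff)
      from order_trans[OF norm_ge_zero bound(1)[OF this, of 0]] show ?thesis by simp
    qed
    define D where "D = C * (C1 + C2)"
    have bd: "cmod (Sn n x * A x + Sn' n x * B x) \<le> D * exp ((cmod (fst x))\<^sup>2 / 4)" if x: "x \<in> Dom" for n x
    proof -
      let ?e = "exp ((cmod (fst x))\<^sup>2 / 8)"
      have "cmod (Sn n x * A x + Sn' n x * B x) \<le> cmod (Sn n x) * cmod (A x) + cmod (Sn' n x) * cmod (B x)"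
        by (metis norm_mult norm_triangle_ineq)
      also have "\<dots> \<le> (C * ?e) * (C1 * ?e) + (C * ?e) * (C2 * ?e)"
        using bound[OF x] C1(2)[OF x] C2(2)[OF x] C0 by (intro add_mono mult_mono) auto
      also have "\<dots> = D * (?e * ?e)" by (simp add: D_def algebra_simps)
      also have "?e * ?e = exp ((cmod (fst x))\<^sup>2 / 4)" by (simp add: exp_add[symmetric])
      finally show ?thesis .
    qed
    have meas: "(\<lambda>x. indicator Dom x *\<^sub>R I S S' x) \<in> borel_measurable lborel" if "tame S" "tame S'" for S S'
    proof -
      have "continuous_on Dom (I S S')"
        unfolding I_def[abs_def]
        by (intro continuous_intros cont_rho tame_continuous[OF that(1)] tame_continuous[OF that(2)]
            tame_continuous[OF tA] tame_continuous[OF tB])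
      then show ?thesis using borel_measurable_continuous_on_indicator[OF Dom_borel] by simp
    qed
    have "(\<lambda>n. LINT x|lborel. indicator Dom x *\<^sub>R I (Sn n) (Sn' n) x)
        \<longlonglongrightarrow> (LINT x|lborel. indicator Dom x *\<^sub>R I S S' x)"
    proof (rule integral_dominated_convergence)
      show "integrable lborel (\<lambda>x. \<bar>indicator Dom x *\<^sub>R (D * (exp ((cmod (fst x))\<^sup>2 / 4) * \<rho> x))\<bar>)"
        using set_integrable_mult_right[OF gauss, of D] unfolding set_integrable_def
        by (intro integrable_abs) simp
      show "AE x in lborel. norm (indicator Dom x *\<^sub>R I (Sn n) (Sn' n) x)
          \<le> \<bar>indicator Dom x *\<^sub>R (D * (exp ((cmod (fst x))\<^sup>2 / 4) * \<rho> x))\<bar>" for n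
      proof (rule AE_I2)
        fix x
        show "norm (indicator Dom x *\<^sub>R I (Sn n) (Sn' n) x)
          \<le> \<bar>indicator Dom x *\<^sub>R (D * (exp ((cmod (fst x))\<^sup>2 / 4) * \<rho> x))\<bar>"
        proof (cases "x \<in> Dom")
          case True
          have "cmod (Sn n x * A x + Sn' n x * B x) * \<bar>\<rho> x\<bar> \<le> (D * exp ((cmod (fst x))\<^sup>2 / 4)) * \<bar>\<rho> x\<bar>"
            by (intro mult_right_mono bd True) auto
          also have "\<dots> \<le> \<bar>D * exp ((cmod (fst x))\<^sup>2 / 4)\<bar> * \<bar>\<rho> x\<bar>" by (intro mult_right_mono) auto
          finally show ?thesis using True by (simp add: I_def norm_mult abs_mult mult.assoc)
        qed simp
      qed
      show "AE x in lborel. (\<lambda>n. indicator Dom x *\<^sub>R I (Sn n) (Sn' n) x) \<longlonglongrightarrow> indicator Dom x *\<^sub>R I S S' x"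
      proof (rule AE_I2)
        fix x
        show "(\<lambda>n. indicator Dom x *\<^sub>R I (Sn n) (Sn' n) x) \<longlonglongrightarrow> indicator Dom x *\<^sub>R I S S' x"
          by (cases "x \<in> Dom") (auto simp: I_def intro!: tendsto_intros lim)
      qed
    qed (intro meas S multiplier_tame[OF M])+
    then have "(LINT x:Dom|lborel. I S S' x) = 0"
      using I0 unfolding set_lebesgue_integral_def by (simp add: LIMSEQ_const_iff)
    then show "(LINT x:Dom|lborel. ((R x * S x + P x * S' x) * mon a b c d x + P x * S x * dmon a b c d x
        - q x * (P x * S x) * mon a b c d x) * complex_of_real (\<rho> x)) = 0"
      unfolding I .
  qed (intro tame_intros weak_tame[OF W] S)+
qed (use S in auto)

end

text \<open>Approximating \<open>f\<close> itself would give no control of the derivative. Instead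
  \<open>f'\<close> is approximated and the polynomial integrated, which bounds the error of the
  primitive by the length of the interval.\<close>

lemma C1_polynomial_approximation:
  fixes f f' :: "real \<Rightarrow> real"
  assumes der: "\<And>t. (f has_real_derivative f' t) (at t)" and cont: "continuous_on UNIV f'"
    and "M \<ge> 0" and "e > 0"
  obtains a :: "nat \<Rightarrow> real" and n :: nat where
    "\<And>t. t \<in> {0..M} \<Longrightarrow> \<bar>(\<Sum>i\<le>n. a i * t ^ i) - f t\<bar> \<le> e"
    "\<And>t. t \<in> {0..M} \<Longrightarrow> \<bar>(\<Sum>i\<le>n. a i * (of_nat i * t ^ (i - 1))) - f' t\<bar> \<le> e"
proof -
  \<comment> \<open>The denominator \<open>M + 1\<close> serves both needs, e' \<le> e for the
    derivative and e' * M \<le> e for the primitive, and also covers M = 0.\<close>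
  define e' where "e' = e / (M + 1)"
  have e': "e' > 0" "e' \<le> e" "e' * M \<le> e"
    using assms by (auto simp: e'_def field_simps)
  obtain g where g: "real_polynomial_function g" "\<And>t. t \<in> {0..M} \<Longrightarrow> \<bar>f' t - g t\<bar> < e'"
    using Stone_Weierstrass_real_polynomial_function[OF compact_Icc continuous_on_subset[OF cont subset_UNIV] e'(1)]
    by blast
  obtain b m where b: "g = (\<lambda>t. \<Sum>i\<le>m. b i * t ^ i)"
    using g(1) unfolding real_polynomial_function_iff_sum by blast
  \<comment> \<open>Coefficients of the primitive of the approximating polynomial, with constant
    term \<open>f 0\<close> so that the error vanishes at 0.\<close>
  define a where "a i = (case i of 0 \<Rightarrow> f 0 | Suc j \<Rightarrow> b j / real (Suc j))" for i
  define p where "p t = (\<Sum>i\<le>Suc m. a i * t ^ i)" for t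
  have dp: "(\<Sum>i\<le>Suc m. a i * (of_nat i * t ^ (i - 1))) = g t" for t
    unfolding b by (subst sum.atMost_Suc_shift) (simp add: a_def del: of_nat_Suc)
  have "(p has_real_derivative (\<Sum>i\<le>Suc m. a i * (of_nat i * t ^ (i - 1)))) (at t)" for t
    unfolding p_def[abs_def] by (auto intro!: derivative_eq_intros simp: mult_ac simp del: sum.atMost_Suc)
  then have derp: "((\<lambda>t. p t - f t) has_real_derivative (g t - f' t)) (at t)" for t
    unfolding dp by (intro DERIV_diff der)
  have p0: "p 0 - f 0 = 0"
    unfolding p_def by (subst sum.atMost_Suc_shift) (simp add: a_def)
  show ?thesis
  proof (rule that[of a "Suc m"])
    fix t assume t: "t \<in> {0..M}"
    show "\<bar>(\<Sum>i\<le>Suc m. a i * (of_nat i * t ^ (i - 1))) - f' t\<bar> \<le> e"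
      unfolding dp using g(2)[OF t] e'(2) by (simp add: abs_minus_commute)
    have "norm ((p t - f t) - (p 0 - f 0)) \<le> e' * norm (t - 0)"
    proof (rule field_differentiable_bound[of "{0..M}" "\<lambda>t. p t - f t" "\<lambda>t. g t - f' t"])
      fix s assume s: "s \<in> {0..M}"
      show "((\<lambda>t. p t - f t) has_field_derivative (g s - f' s)) (at s within {0..M})"
        by (rule has_field_derivative_at_within[OF derp])
      show "norm (g s - f' s) \<le> e'" using g(2)[OF s] by (simp add: abs_minus_commute)
    qed (use t in auto)
    also have "\<dots> \<le> e' * M" using t e'(1) by (intro mult_left_mono) auto
    also note \<open>e' * M \<le> e\<close>
    finally show "\<bar>(\<Sum>i\<le>Suc m. a i * t ^ i) - f t\<bar> \<le> e"
      unfolding p0 by (simp add: p_def)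
  qed
qed

section \<open>From polynomials to Gaussian and cut-off multipliers\<close>

context weak_equation
begin

text \<open>The chain rule survives the limit once the polynomials and their formal derivatives
  converge together. The rate 1/16 leaves another 1/16 for the tame factor \<open>S'\<close>, within
  the 1/8 of \<open>multiplier_limit\<close>.\<close>

lemma multiplier_poly_limit:
  fixes N :: "nat \<Rightarrow> nat"
  assumes S: "multiplier S S'" and f: "tame f" "tame f'"
    and lim: "\<And>x. x \<in> Dom \<Longrightarrow> (\<lambda>n. \<Sum>i\<le>N n. a n i * S x ^ i) \<longlonglongrightarrow> f x"
      "\<And>x. x \<in> Dom \<Longrightarrow> (\<lambda>n. \<Sum>i\<le>N n. a n i * (of_nat i * S x ^ (i - 1))) \<longlonglongrightarrow> f' x"
    and bound: "\<And>n x. x \<in> Dom \<Longrightarrow> cmod (\<Sum>i\<le>N n. a n i * S x ^ i) \<le> C * exp ((cmod (fst x))\<^sup>2 / 16)"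
      "\<And>n x. x \<in> Dom \<Longrightarrow> cmod (\<Sum>i\<le>N n. a n i * (of_nat i * S x ^ (i - 1))) \<le> C * exp ((cmod (fst x))\<^sup>2 / 16)"
  shows "multiplier f (\<lambda>x. f' x * S' x)"
proof -
  obtain D where D: "D \<ge> 0" "\<And>x. x \<in> Dom \<Longrightarrow> cmod (S' x) \<le> D * exp (1/16 * (cmod (fst x))\<^sup>2)"
    using tameE[OF multiplier_tame(2)[OF S], of "1/16"] by auto
  have C0: "C \<ge> 0"
  proof -
    have "(0, 0) \<in> Dom" by (simp add: Dom_iff)
    from order_trans[OF norm_ge_zero bound(1)[OF this, of 0]] show ?thesis by simp
  qed
  define K where "K = C * (D + 1)"
  have K: "C \<le> K" "C * D \<le> K" using C0 D(1) by (auto simp: K_def algebra_simps)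
  show ?thesis
  proof (rule multiplier_limit[where C = K])
    show "multiplier (\<lambda>x. \<Sum>i\<le>N n. a n i * S x ^ i) (\<lambda>x. (\<Sum>i\<le>N n. a n i * (of_nat i * S x ^ (i - 1))) * S' x)" for n
      by (rule multiplier_poly[OF S])
    show "tame f" "tame (\<lambda>x. f' x * S' x)"
      by (intro tame_intros f multiplier_tame(2)[OF S])+
    show "(\<lambda>n. \<Sum>i\<le>N n. a n i * S x ^ i) \<longlonglongrightarrow> f x" if "x \<in> Dom" for x
      by (rule lim(1)[OF that])
    show "(\<lambda>n. (\<Sum>i\<le>N n. a n i * (of_nat i * S x ^ (i - 1))) * S' x) \<longlonglongrightarrow> f' x * S' x"
      if "x \<in> Dom" for x
      by (rule tendsto_mult_right[OF lim(2)[OF that]])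
    fix n x assume x: "x \<in> Dom"
    let ?e = "exp ((cmod (fst x))\<^sup>2 / 16)"
    have ee: "?e * ?e = exp ((cmod (fst x))\<^sup>2 / 8)" by (simp add: exp_add[symmetric])
    have "C * ?e \<le> C * (?e * ?e)" using C0 by (intro mult_left_mono) auto
    also have "\<dots> \<le> K * (?e * ?e)" using K by (intro mult_right_mono) auto
    finally show "cmod (\<Sum>i\<le>N n. a n i * S x ^ i) \<le> K * exp ((cmod (fst x))\<^sup>2 / 8)"
      unfolding ee using bound(1)[OF x, of n] by linarith
    have "cmod ((\<Sum>i\<le>N n. a n i * (of_nat i * S x ^ (i - 1))) * S' x) \<le> (C * ?e) * (D * ?e)"
      unfolding norm_mult using bound(2)[OF x] D(2)[OF x] C0 by (intro mult_mono) auto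
    also have "\<dots> = (C * D) * (?e * ?e)" by (simp add: algebra_simps)
    also have "\<dots> \<le> K * (?e * ?e)" using K by (intro mult_right_mono) auto
    finally show "cmod ((\<Sum>i\<le>N n. a n i * (of_nat i * S x ^ (i - 1))) * S' x) \<le> K * exp ((cmod (fst x))\<^sup>2 / 8)"
      unfolding ee .
  qed
qed

text \<open>The hypothesis bounds the modulus of \<open>S\<close>, not its real part: even where
  exp(S) is small, the partial sums of its series are only controlled by exp |S|.\<close>

lemma multiplier_exp:
  assumes S: "multiplier S S'" and tame: "tame (\<lambda>x. exp (S x))"
    and bound: "\<And>x. x \<in> Dom \<Longrightarrow> cmod (S x) \<le> K + (cmod (fst x))\<^sup>2 / 16"
  shows "multiplier (\<lambda>x. exp (S x)) (\<lambda>x. exp (S x) * S' x)"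
proof -
  \<comment> \<open>Formal differentiation of the exponential sum drops its last term, so both
    sequences are partial sums of the same series.\<close>
  have der: "(\<Sum>i\<le>n. (1 / fact i) * (of_nat i * t ^ (i - 1))) = (\<Sum>i<n. (1 / fact i) * t ^ i)"
    for n :: nat and t :: complex
  proof -
    have "(1 / fact (Suc i)) * of_nat (Suc i) = 1 / (fact i :: complex)" for i
      by (simp add: divide_simps del: of_nat_Suc)
    then show ?thesis
      by (simp only: sum.atMost_shift mult.assoc[symmetric]) simp
  qed
  have sums: "(\<lambda>i. (1 / fact i) * t ^ i) sums exp t" for t :: complex
    using exp_converges[of t] by (simp add: scaleR_conv_of_real field_simps)
  have le: "cmod (\<Sum>i\<in>I. (1 / fact i) * t ^ i) \<le> exp (cmod t)" if "finite I" for I and t :: complex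
  proof -
    have s: "(\<lambda>i. (1 / fact i) * cmod t ^ i) sums exp (cmod t)"
      using exp_converges[of "cmod t"] by (simp add: field_simps)
    have "cmod (\<Sum>i\<in>I. (1 / fact i) * t ^ i) \<le> (\<Sum>i\<in>I. (1 / fact i) * cmod t ^ i)"
      by (rule order_trans[OF norm_sum]) (simp add: norm_mult norm_divide norm_power)
    also have "\<dots> \<le> exp (cmod t)"
      unfolding sums_unique[OF s] using that s by (intro sum_le_suminf) (auto simp: sums_iff)
    finally show ?thesis .
  qed
  have expb: "exp (cmod (S x)) \<le> exp K * exp ((cmod (fst x))\<^sup>2 / 16)" if "x \<in> Dom" for x
    using bound[OF that] by (simp add: exp_add[symmetric])
  show ?thesis
  proof (rule multiplier_poly_limit[OF S tame tame, where a = "\<lambda>_ i. 1 / fact i" and N = "\<lambda>n. n" and C = "exp K"])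
    fix x assume x: "x \<in> Dom"
    show "(\<lambda>n. \<Sum>i\<le>n. 1 / fact i * S x ^ i) \<longlonglongrightarrow> exp (S x)"
      using sums by (simp add: sums_def_le)
    show "(\<lambda>n. \<Sum>i\<le>n. 1 / fact i * (of_nat i * S x ^ (i - 1))) \<longlonglongrightarrow> exp (S x)"
      unfolding der using sums by (simp add: sums_def)
    show "cmod (\<Sum>i\<le>n. 1 / fact i * S x ^ i) \<le> exp K * exp ((cmod (fst x))\<^sup>2 / 16)" for n
      using le[of "{..n}" "S x"] expb[OF x] by simp
    show "cmod (\<Sum>i\<le>n. 1 / fact i * (of_nat i * S x ^ (i - 1))) \<le> exp K * exp ((cmod (fst x))\<^sup>2 / 16)" for n
      unfolding der using le[of "{..<n}" "S x"] expb[OF x] by simp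
  qed
qed

text \<open>The values of \<open>s\<close> stay in a compact interval, where polynomials approximate
  \<open>f\<close> and \<open>f'\<close> simultaneously. The approximants are thus uniformly bounded
  on the whole domain, unbounded in z though it is.\<close>

lemma multiplier_C1_compose:
  fixes f f' :: "real \<Rightarrow> real"
  assumes der: "\<And>t. (f has_real_derivative f' t) (at t)" and cont: "continuous_on UNIV f'"
    and S: "multiplier (\<lambda>x. of_real (s x)) S'" and s: "continuous_on Dom s" "\<And>x. x \<in> Dom \<Longrightarrow> s x \<in> {0..M}"
  shows "multiplier (\<lambda>x. of_real (f (s x))) (\<lambda>x. of_real (f' (s x)) * S' x)"
proof -
  have M: "M \<ge> 0" using s(2)[of "(0, 0)"] by (auto simp: Dom_iff)
  have contf: "continuous_on UNIV f"
    by (intro continuous_at_imp_continuous_on ballI DERIV_isCont[OF der])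
  have "compact (f ` {0..M})" "compact (f' ` {0..M})"
    by (intro compact_continuous_image continuous_on_subset[OF contf] continuous_on_subset[OF cont] compact_Icc subset_UNIV)+
  then obtain B B' where B: "\<And>t. t \<in> {0..M} \<Longrightarrow> \<bar>f t\<bar> \<le> B" "\<And>t. t \<in> {0..M} \<Longrightarrow> \<bar>f' t\<bar> \<le> B'"
    by (metis (no_types, opaque_lifting) bounded_iff compact_imp_bounded imageI real_norm_def)
  \<comment> \<open>The summand 1 accounts for the approximation error
    \<open>1 / real (Suc j)\<close>, which is at most 1.\<close>
  define C where "C = max B B' + 1"
  have ex: "\<exists>a n. \<forall>t\<in>{0..M}. \<bar>(\<Sum>i\<le>n. a i * t ^ i) - f t\<bar> \<le> 1 / real (Suc j) \<and>
      \<bar>(\<Sum>i\<le>n. a i * (of_nat i * t ^ (i - 1))) - f' t\<bar> \<le> 1 / real (Suc j)" for j :: nat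
  proof -
    have "1 / real (Suc j) > 0" by simp
    then obtain a :: "nat \<Rightarrow> real" and n :: nat where
      "\<And>t. t \<in> {0..M} \<Longrightarrow> \<bar>(\<Sum>i\<le>n. a i * t ^ i) - f t\<bar> \<le> 1 / real (Suc j)"
      "\<And>t. t \<in> {0..M} \<Longrightarrow> \<bar>(\<Sum>i\<le>n. a i * (of_nat i * t ^ (i - 1))) - f' t\<bar> \<le> 1 / real (Suc j)"
      by (rule C1_polynomial_approximation[OF der cont M]) (rule that)
    then show ?thesis by (intro exI[of _ a] exI[of _ n] ballI conjI)
  qed
  from choice[OF allI[OF ex]] obtain a :: "nat \<Rightarrow> nat \<Rightarrow> real" where
    "\<forall>j. \<exists>n. \<forall>t\<in>{0..M}. \<bar>(\<Sum>i\<le>n. a j i * t ^ i) - f t\<bar> \<le> 1 / real (Suc j) \<and>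
      \<bar>(\<Sum>i\<le>n. a j i * (of_nat i * t ^ (i - 1))) - f' t\<bar> \<le> 1 / real (Suc j)" ..
  from choice[OF this] obtain N :: "nat \<Rightarrow> nat" where
    "\<forall>j. \<forall>t\<in>{0..M}. \<bar>(\<Sum>i\<le>N j. a j i * t ^ i) - f t\<bar> \<le> 1 / real (Suc j) \<and>
      \<bar>(\<Sum>i\<le>N j. a j i * (of_nat i * t ^ (i - 1))) - f' t\<bar> \<le> 1 / real (Suc j)" ..
  then have a: "\<bar>(\<Sum>i\<le>N j. a j i * t ^ i) - f t\<bar> \<le> 1 / real (Suc j)"
    "\<bar>(\<Sum>i\<le>N j. a j i * (of_nat i * t ^ (i - 1))) - f' t\<bar> \<le> 1 / real (Suc j)" if "t \<in> {0..M}" for j t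
    using that by blast+
  have lim: "X \<longlonglongrightarrow> l" if "\<And>j. \<bar>X j - l\<bar> \<le> 1 / real (Suc j)" for X and l :: real
  proof -
    have "(\<lambda>j. X j - l) \<longlonglongrightarrow> 0"
      by (rule Lim_null_comparison[OF _ LIMSEQ_inverse_real_of_nat])
        (use that in \<open>auto simp: inverse_eq_divide\<close>)
    then show ?thesis by (simp add: LIM_zero_iff)
  qed
  have cf: "continuous_on Dom (\<lambda>x. f (s x))" "continuous_on Dom (\<lambda>x. f' (s x))"
    by (rule continuous_on_compose2[OF contf s(1)], simp, rule continuous_on_compose2[OF cont s(1)], simp)
  have one: "1 / real (Suc j) \<le> 1" for j by simp
  have C: "C \<le> C * exp r" if "r \<ge> 0" for r
  proof -
    have "C \<ge> 0" using B(1)[of 0] M by (auto simp: C_def max_def)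
    then have "C * 1 \<le> C * exp r" using that by (intro mult_left_mono) auto
    then show ?thesis by simp
  qed
  show ?thesis
  proof (rule multiplier_poly_limit[OF S, where a = "\<lambda>j i. of_real (a j i)" and N = N and C = C])
    show "tame (\<lambda>x. complex_of_real (f (s x)))"
      using B(1) s(2) by (intro tame_bounded[of _ B] continuous_intros cf) auto
    show "tame (\<lambda>x. complex_of_real (f' (s x)))"
      using B(2) s(2) by (intro tame_bounded[of _ B'] continuous_intros cf) auto
    fix x assume x: "x \<in> Dom"
    note sx = s(2)[OF x]
    have p: "(\<Sum>i\<le>N j. complex_of_real (a j i) * complex_of_real (s x) ^ i) = of_real (\<Sum>i\<le>N j. a j i * s x ^ i)"
      "(\<Sum>i\<le>N j. complex_of_real (a j i) * (of_nat i * complex_of_real (s x) ^ (i - 1)))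
        = of_real (\<Sum>i\<le>N j. a j i * (of_nat i * s x ^ (i - 1)))" for j
      by simp_all
    show "(\<lambda>j. \<Sum>i\<le>N j. complex_of_real (a j i) * complex_of_real (s x) ^ i) \<longlonglongrightarrow> complex_of_real (f (s x))"
      unfolding p by (intro tendsto_of_real lim a sx)
    show "(\<lambda>j. \<Sum>i\<le>N j. complex_of_real (a j i) * (of_nat i * complex_of_real (s x) ^ (i - 1)))
        \<longlonglongrightarrow> complex_of_real (f' (s x))"
      unfolding p by (intro tendsto_of_real lim a sx)
    show "cmod (\<Sum>i\<le>N j. complex_of_real (a j i) * complex_of_real (s x) ^ i)
        \<le> C * exp ((cmod (fst x))\<^sup>2 / 16)" for j
    proof -
      have "\<bar>\<Sum>i\<le>N j. a j i * s x ^ i\<bar> \<le> C"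
        using a(1)[OF sx, of j] B(1)[OF sx] one[of j] unfolding C_def by linarith
      then show ?thesis unfolding p norm_of_real using C[of "(cmod (fst x))\<^sup>2 / 16"] by auto
    qed
    show "cmod (\<Sum>i\<le>N j. complex_of_real (a j i) * (of_nat i * complex_of_real (s x) ^ (i - 1)))
        \<le> C * exp ((cmod (fst x))\<^sup>2 / 16)" for j
    proof -
      have "\<bar>\<Sum>i\<le>N j. a j i * (of_nat i * s x ^ (i - 1))\<bar> \<le> C"
        using a(2)[OF sx, of j] B(2)[OF sx] one[of j] unfolding C_def by linarith
      then show ?thesis unfolding p norm_of_real using C[of "(cmod (fst x))\<^sup>2 / 16"] by auto
    qed
  qed
qed

lemma multiplier_norm_square:
  assumes "multiplier S S'" and "multiplier (\<lambda>x. cnj (S x)) S''"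
  shows "multiplier (\<lambda>x. of_real ((cmod (S x - c))\<^sup>2)) (\<lambda>x. S' x * cnj (S x - c) + (S x - c) * S'' x)"
proof -
  have "multiplier (\<lambda>x. S x + - c) (\<lambda>x. S' x + 0)" "multiplier (\<lambda>x. cnj (S x) + - cnj c) (\<lambda>x. S'' x + 0)"
    by (intro multiplier_add assms multiplier_const)+
  from multiplier_mult[OF this] show ?thesis
    by (simp only: complex_norm_square) simp
qed

text \<open>The rate 1/32 is forced by |z - c|^2 \<le> 2 |z|^2 + 2 |c|^2: half of 1/16 keeps the
  exponent within the bound of \<open>multiplier_exp\<close> for every centre
  \<open>c\<close>.\<close>

lemma multiplier_gaussian:
  "multiplier (\<lambda>x. of_real (exp (- (cmod (fst x - c))\<^sup>2 / 32)))
     (\<lambda>x. of_real (exp (- (cmod (fst x - c))\<^sup>2 / 32))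
        * (- 1 / 32 * (\<xi>1 x * cnj (fst x - c) + (fst x - c) * \<xi>2 x)))"
proof -
  let ?S = "\<lambda>x::complex \<times> complex. - 1 / 32 * complex_of_real ((cmod (fst x - c))\<^sup>2)"
  have S: "multiplier ?S (\<lambda>x. - 1 / 32 * (\<xi>1 x * cnj (fst x - c) + (fst x - c) * \<xi>2 x))"
    by (intro multiplier_cmult multiplier_norm_square multiplier_fst multiplier_cnj_fst)
  have e: "exp (?S x) = complex_of_real (exp (- (cmod (fst x - c))\<^sup>2 / 32))" for x
    by (simp add: exp_of_real[symmetric])
  have "multiplier (\<lambda>x. exp (?S x)) (\<lambda>x. exp (?S x) * (- 1 / 32 * (\<xi>1 x * cnj (fst x - c) + (fst x - c) * \<xi>2 x)))"
  proof (rule multiplier_exp[OF S, of "(cmod c)\<^sup>2 / 16"])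
    show "tame (\<lambda>x. exp (?S x))"
      unfolding e by (rule tame_bounded[of _ 1]) (auto intro!: continuous_intros)
    fix x :: "complex \<times> complex"
    have "(cmod (fst x - c))\<^sup>2 \<le> (cmod (fst x) + cmod c)\<^sup>2"
      by (intro power_mono norm_triangle_ineq4) auto
    also have "\<dots> \<le> 2 * (cmod (fst x))\<^sup>2 + 2 * (cmod c)\<^sup>2"
      using zero_le_power2[of "cmod (fst x) - cmod c"] by (simp add: power2_eq_square algebra_simps)
    finally show "cmod (?S x) \<le> (cmod c)\<^sup>2 / 16 + (cmod (fst x))\<^sup>2 / 16"
      by (simp add: norm_mult norm_power)
  qed
  then show ?thesis unfolding e .
qed

text \<open>On the domain \<open>u\<close> takes values in (0, 1] and \<open>v\<close> in a bounded
  interval, so arbitrary C^1 functions of either are multipliers. Cut-offs around any point are of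
  this product shape.\<close>

lemma weak_product_test_function:
  fixes f f' g g' :: "real \<Rightarrow> real" and z0 w0 :: complex
  defines "u \<equiv> \<lambda>x::complex \<times> complex. exp (- (cmod (fst x - z0))\<^sup>2 / 32)"
    and "v \<equiv> \<lambda>x::complex \<times> complex. (cmod (snd x - w0))\<^sup>2"
  assumes f: "\<And>t. (f has_real_derivative f' t) (at t)" "continuous_on UNIV f'"
    and g: "\<And>t. (g has_real_derivative g' t) (at t)" "continuous_on UNIV g'"
  shows "(LINT x:Dom|lborel. (of_real (f' (u x)) * (of_real (u x)
          * (- 1 / 32 * (\<xi>1 x * cnj (fst x - z0) + (fst x - z0) * \<xi>2 x))) * of_real (g (v x))
       + of_real (f (u x)) * (of_real (g' (v x)) * (\<xi>3 x * cnj (snd x - w0) + (snd x - w0) * \<xi>4 x))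
       - q x * (of_real (f (u x)) * of_real (g (v x)))) * of_real (\<rho> x)) = 0"
proof -
  have "multiplier (\<lambda>x. of_real (f (u x))) (\<lambda>x. of_real (f' (u x)) * (of_real (u x)
          * (- 1 / 32 * (\<xi>1 x * cnj (fst x - z0) + (fst x - z0) * \<xi>2 x))))"
  proof (rule multiplier_C1_compose[OF f, where M = 1])
    show "multiplier (\<lambda>x. of_real (u x)) (\<lambda>x. of_real (u x) * (- 1 / 32 * (\<xi>1 x * cnj (fst x - z0) + (fst x - z0) * \<xi>2 x)))"
      unfolding u_def by (rule multiplier_gaussian)
  qed (auto simp: u_def intro!: continuous_intros)
  moreover have "multiplier (\<lambda>x. of_real (g (v x))) (\<lambda>x. of_real (g' (v x)) * (\<xi>3 x * cnj (snd x - w0) + (snd x - w0) * \<xi>4 x))"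
  proof (rule multiplier_C1_compose[OF g, where M = "(1 + cmod w0)\<^sup>2"])
    show "multiplier (\<lambda>x. of_real (v x)) (\<lambda>x. \<xi>3 x * cnj (snd x - w0) + (snd x - w0) * \<xi>4 x)"
      unfolding v_def by (intro multiplier_norm_square multiplier_snd multiplier_cnj_snd)
    fix x :: "complex \<times> complex" assume "x \<in> Dom"
    then have "cmod (snd x) \<le> 1" by (auto simp: Dom_def)
    then have "cmod (snd x - w0) \<le> 1 + cmod w0" using norm_triangle_ineq4[of "snd x" w0] by linarith
    then show "v x \<in> {0..(1 + cmod w0)\<^sup>2}" unfolding v_def by (auto intro!: power_mono)
  qed (auto simp: v_def intro!: continuous_intros)
  ultimately have M: "multiplier (\<lambda>x. of_real (f (u x)) * of_real (g (v x)))
     (\<lambda>x. of_real (f' (u x)) * (of_real (u x)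
          * (- 1 / 32 * (\<xi>1 x * cnj (fst x - z0) + (fst x - z0) * \<xi>2 x))) * of_real (g (v x))
       + of_real (f (u x)) * (of_real (g' (v x)) * (\<xi>3 x * cnj (snd x - w0) + (snd x - w0) * \<xi>4 x)))"
    (is "multiplier ?S ?S'") by (rule multiplier_mult)
  \<comment> \<open>The multiplier is applied to the constant 1, and the result is read off at the
    trivial monomial.\<close>
  have "weak (\<lambda>x. 1 * ?S x) (\<lambda>x. 0 * ?S x + 1 * ?S' x)"
    using M weak_one unfolding multiplier_def by blast
  then have "weak ?S ?S'" by simp
  then have "(LINT x:Dom|lborel. (?S' x * mon 0 0 0 0 x + ?S x * dmon 0 0 0 0 x - q x * ?S x * mon 0 0 0 0 x) * of_real (\<rho> x)) = 0"
    unfolding weak_def by blast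
  then show ?thesis by (simp add: mon_def mon_deriv_def)
qed

end

section \<open>From the weak to the strong equation\<close>

text \<open>The square of the positive part is the profile of the cut-offs: it vanishes on a
  half-line and is C^1, the regularity that polynomial approximation and one integration by parts
  require.\<close>

lemma pos_part_square_has_derivative:
  "((\<lambda>t::real. (max 0 t)\<^sup>2) has_real_derivative 2 * max 0 t) (at t)"
proof -
  consider "t > 0" | "t < 0" | "t = 0" by linarith
  then show ?thesis
  proof cases
    case 1
    have "((\<lambda>t::real. t\<^sup>2) has_real_derivative 2 * t) (at t)"
      by (auto intro!: derivative_eq_intros)
    then have "((\<lambda>t::real. (max 0 t)\<^sup>2) has_real_derivative 2 * t) (at t)"
      by (rule has_field_derivative_transform_within_open[of _ _ _ "{0<..}"]) (use 1 in auto)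
    then show ?thesis using 1 by simp
  next
    case 2
    have "((\<lambda>t::real. 0) has_real_derivative 0) (at t)" by simp
    then have "((\<lambda>t::real. (max 0 t)\<^sup>2) has_real_derivative 0) (at t)"
      by (rule has_field_derivative_transform_within_open[of _ _ _ "{..<0}"]) (use 2 in auto)
    then show ?thesis using 2 by simp
  next
    case 3
    have "((\<lambda>h::real. max 0 h) \<longlongrightarrow> max 0 0) (at 0)" by (intro tendsto_intros)
    then have "((\<lambda>h::real. max 0 h) \<longlongrightarrow> 0) (at 0)" by simp
    then have "((\<lambda>h. ((max 0 (0 + h))\<^sup>2 - (max 0 (0::real))\<^sup>2) / h) \<longlongrightarrow> 0) (at 0)"
      by (rule Lim_transform_eventually[OF _ eventually_mono[OF eventually_neq_at_within[of 0]]])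
        (auto simp: max_def power2_eq_square)
    then show ?thesis using 3 by (simp add: DERIV_def)
  qed
qed

context weak_equation
begin

text \<open>Moving the derivatives from a bump onto each coefficient times \<rho> turns the weak
  identity into an integral of the bump against the left-hand side; the bumps may be concentrated at
  \<open>x0\<close>.\<close>

lemma strong_equation:
  assumes r: "C1_with (\<lambda>x. complex_of_real (\<rho> x)) r'"
    and xi: "C1_with \<xi>1 \<xi>1'" "C1_with \<xi>2 \<xi>2'" "C1_with \<xi>3 \<xi>3'" "C1_with \<xi>4 \<xi>4'"
    and x0: "x0 \<in> Dom"
  shows "dz (\<lambda>x. \<xi>1 x * of_real (\<rho> x)) x0 + dzb (\<lambda>x. \<xi>2 x * of_real (\<rho> x)) x0
       + dw (\<lambda>x. \<xi>3 x * of_real (\<rho> x)) x0 + dwb (\<lambda>x. \<xi>4 x * of_real (\<rho> x)) x0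
       + q x0 * of_real (\<rho> x0) = 0"
proof -
  define g1 g2 g3 g4 where "g1 x = \<xi>1 x * complex_of_real (\<rho> x)" and "g2 x = \<xi>2 x * complex_of_real (\<rho> x)"
    and "g3 x = \<xi>3 x * complex_of_real (\<rho> x)" and "g4 x = \<xi>4 x * complex_of_real (\<rho> x)" for x
  note g_defs = g1_def g2_def g3_def g4_def
  obtain g1' g2' g3' g4' where g: "C1_with g1 g1'" "C1_with g2 g2'" "C1_with g3 g3'" "C1_with g4 g4'"
    unfolding g_defs[abs_def] using C1_with_mult[OF xi(1) r] C1_with_mult[OF xi(2) r]
      C1_with_mult[OF xi(3) r] C1_with_mult[OF xi(4) r] by blast
  define E where "E x = dz g1 x + dzb g2 x + dw g3 x + dwb g4 x + q x * of_real (\<rho> x)" for x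
  have cE: "continuous_on Dom E"
    unfolding E_def[abs_def] wirtinger_simps
    by (intro continuous_intros continuous_on_wirtinger[OF g(1)] continuous_on_wirtinger[OF g(2)]
        continuous_on_wirtinger[OF g(3)] continuous_on_wirtinger[OF g(4)]
        tame_continuous[OF tame_q] cont_rho)
  have "E x0 = 0"
  proof (rule eq_0_of_localized_integrals[OF cE x0])
    fix d :: real assume d: "d > 0" "cball x0 d \<subseteq> Dom"
    define z0 w0 where "z0 = fst x0" and "w0 = snd x0"
    \<comment> \<open>The threshold \<open>a\<close> is the value of the Gaussian at distance
      \<open>e\<close>, so f(u) is nonzero exactly for |z - z0| < e. With e = d/2 the product of two
      discs lies in the ball of radius \<open>d\<close>.\<close>
    define e a where "e = d / 2" and "a = exp (- e\<^sup>2 / 32)"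
    have e: "e > 0" using d by (simp add: e_def)
    define f f' g g' :: "real \<Rightarrow> real" where "f t = (max 0 (t - a))\<^sup>2" and "f' t = 2 * max 0 (t - a)"
      and "g t = (max 0 (e\<^sup>2 - t))\<^sup>2" and "g' t = - (2 * max 0 (e\<^sup>2 - t))" for t
    have f: "(f has_real_derivative f' t) (at t)" for t
    proof -
      have "((\<lambda>t. t - a) has_real_derivative 1) (at t)" by (auto intro!: derivative_eq_intros)
      from DERIV_chain2[OF pos_part_square_has_derivative this]
      show ?thesis unfolding f_def[abs_def] f'_def by simp
    qed
    have g: "(g has_real_derivative g' t) (at t)" for t
    proof -
      have "((\<lambda>t. e\<^sup>2 - t) has_real_derivative - 1) (at t)" by (auto intro!: derivative_eq_intros)
      from DERIV_chain2[OF pos_part_square_has_derivative this]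
      show ?thesis unfolding g_def[abs_def] g'_def by simp
    qed
    have cf: "continuous_on A f" "continuous_on A f'" "continuous_on A g" "continuous_on A g'" for A
      unfolding f_def[abs_def] f'_def[abs_def] g_def[abs_def] g'_def[abs_def] by (intro continuous_intros)+
    define u v where "u x = exp (- (cmod (fst x - z0))\<^sup>2 / 32)" and "v x = (cmod (snd x - w0))\<^sup>2"
      for x :: "complex \<times> complex"
    define P where "P x = f (u x) * g (v x)" for x
    \<comment> \<open>The factor 1/16 is 2/32, as the real derivative of |z - z0|^2 is twice an
      inner product.\<close>
    define P' where "P' x h = f' (u x) * (u x * (- 1 / 16 * ((fst x - z0) \<bullet> fst h))) * g (v x)
        + f (u x) * (g' (v x) * (2 * ((snd x - w0) \<bullet> snd h)))" for x h
    have derP: "(P has_derivative P' x) (at x)" for x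
    proof -
      have "(u has_derivative (\<lambda>h. u x * (- 1 / 16 * ((fst x - z0) \<bullet> fst h)))) (at x)"
        unfolding u_def[abs_def] power2_norm_eq_inner
        by (auto intro!: derivative_eq_intros simp: inner_commute)
      from DERIV_compose_FDERIV[OF f this]
      have fu: "((\<lambda>x. f (u x)) has_derivative (\<lambda>h. f' (u x) * (u x * (- 1 / 16 * ((fst x - z0) \<bullet> fst h))))) (at x)"
        by (simp add: mult.commute)
      have "(v has_derivative (\<lambda>h. 2 * ((snd x - w0) \<bullet> snd h))) (at x)"
        unfolding v_def[abs_def] power2_norm_eq_inner
        by (auto intro!: derivative_eq_intros simp: inner_commute)
      from DERIV_compose_FDERIV[OF g this]
      have gv: "((\<lambda>x. g (v x)) has_derivative (\<lambda>h. g' (v x) * (2 * ((snd x - w0) \<bullet> snd h)))) (at x)"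
        by (simp add: mult.commute)
      show ?thesis
        using has_derivative_mult[OF fu gv] unfolding P_def[abs_def] P'_def[abs_def]
        by (simp add: add.commute)
    qed
    define Q where "Q x = complex_of_real (P x)" for x
    have derQ: "(Q has_derivative (\<lambda>h. complex_of_real (P' x h))) (at x)" for x
      unfolding Q_def[abs_def] by (rule has_derivative_of_real[OF derP])
    have cu: "continuous_on A u" "continuous_on A v" for A
      unfolding u_def[abs_def] v_def[abs_def] by (intro continuous_intros; simp)+
    have cQ': "continuous_on UNIV (\<lambda>x. complex_of_real (P' x h))" for h
      unfolding P'_def
      by (intro continuous_intros continuous_on_compose2[OF cf(1)[of UNIV] cu(1)] continuous_on_compose2[OF cf(2)[of UNIV] cu(1)]
          continuous_on_compose2[OF cf(3)[of UNIV] cu(2)] continuous_on_compose2[OF cf(4)[of UNIV] cu(2)] cu subset_UNIV)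
    have P0: "P x = 0" if "x \<notin> cball x0 d" for x
    proof (rule ccontr)
      assume "P x \<noteq> 0"
      then have "u x > a" "v x < e\<^sup>2"
        by (auto simp: P_def f_def g_def max_def split: if_splits)
      then have "(cmod (fst x - z0))\<^sup>2 < e\<^sup>2" "(cmod (snd x - w0))\<^sup>2 < e\<^sup>2"
        by (auto simp: u_def v_def a_def)
      then have "cmod (fst x - z0) < e" "cmod (snd x - w0) < e"
        using e power_less_imp_less_base[of _ 2 e] by auto
      moreover have "norm (x - x0) \<le> cmod (fst x - z0) + cmod (snd x - w0)"
        using norm_Pair_le[of "fst x - z0" "snd x - w0"] by (simp add: z0_def w0_def minus_prod_def)
      ultimately have "dist x0 x \<le> d" by (simp add: e_def dist_norm norm_minus_commute)
      then show False using that by simp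
    qed
    have Q0: "Q x = 0" if "x \<notin> cball x0 d" for x using P0[OF that] by (simp add: Q_def)
    \<comment> \<open>The half in the Wirtinger derivatives turns 1/16 back into 1/32, so the formal
      derivatives carried along by the multipliers are the actual derivatives of the bump.\<close>
    have W: "dz Q x = of_real (f' (u x)) * (of_real (u x) * (- 1 / 32 * cnj (fst x - z0))) * of_real (g (v x))"
      "dzb Q x = of_real (f' (u x)) * (of_real (u x) * (- 1 / 32 * (fst x - z0))) * of_real (g (v x))"
      "dw Q x = of_real (f (u x)) * (of_real (g' (v x)) * cnj (snd x - w0))"
      "dwb Q x = of_real (f (u x)) * (of_real (g' (v x)) * (snd x - w0))" for x
      unfolding wirtinger_simps wirtinger_eq[OF derQ] P'_def
      by (auto simp: complex_eq_iff inner_complex_def field_simps)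
    have parts:
      "set_integrable lborel Dom (\<lambda>x. g1 x * dz Q x)" "set_integrable lborel Dom (\<lambda>x. dz g1 x * Q x)"
      "(LINT x:Dom|lborel. g1 x * dz Q x) = - (LINT x:Dom|lborel. dz g1 x * Q x)"
      "set_integrable lborel Dom (\<lambda>x. g2 x * dzb Q x)" "set_integrable lborel Dom (\<lambda>x. dzb g2 x * Q x)"
      "(LINT x:Dom|lborel. g2 x * dzb Q x) = - (LINT x:Dom|lborel. dzb g2 x * Q x)"
      "set_integrable lborel Dom (\<lambda>x. g3 x * dw Q x)" "set_integrable lborel Dom (\<lambda>x. dw g3 x * Q x)"
      "(LINT x:Dom|lborel. g3 x * dw Q x) = - (LINT x:Dom|lborel. dw g3 x * Q x)"
      "set_integrable lborel Dom (\<lambda>x. g4 x * dwb Q x)" "set_integrable lborel Dom (\<lambda>x. dwb g4 x * Q x)"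
      "(LINT x:Dom|lborel. g4 x * dwb Q x) = - (LINT x:Dom|lborel. dwb g4 x * Q x)"
      unfolding wirtinger_simps
      by (rule wirtinger_by_parts[OF compact_cball d(2) Q0 derQ cQ' \<open>C1_with g1 g1'\<close>]
          wirtinger_by_parts[OF compact_cball d(2) Q0 derQ cQ' \<open>C1_with g2 g2'\<close>]
          wirtinger_by_parts[OF compact_cball d(2) Q0 derQ cQ' \<open>C1_with g3 g3'\<close>]
          wirtinger_by_parts[OF compact_cball d(2) Q0 derQ cQ' \<open>C1_with g4 g4'\<close>]; assumption)+
    have contP: "continuous_on A P" for A
      by (intro continuous_at_imp_continuous_on ballI has_derivative_continuous[OF derP])
    have iq: "set_integrable lborel Dom (\<lambda>x. q x * of_real (\<rho> x) * Q x)"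
      by (rule set_integrable_compact_support[OF _ compact_cball d(2)])
        (auto simp: Q0 Q_def intro!: continuous_intros contP tame_continuous[OF tame_q] cont_rho simp: P0)
    have "0 = (LINT x:Dom|lborel. g1 x * dz Q x + g2 x * dzb Q x + g3 x * dw Q x + g4 x * dwb Q x
        - q x * of_real (\<rho> x) * Q x)"
      unfolding weak_product_test_function[OF f cf(2) g cf(4), of z0 w0, symmetric]
      unfolding W unfolding g_defs Q_def P_def u_def v_def
      by (intro arg_cong[of _ _ "set_lebesgue_integral lborel Dom"] ext)
        (simp add: algebra_simps add_divide_distrib diff_divide_distrib)
    also have "\<dots> = - (LINT x:Dom|lborel. dz g1 x * Q x + dzb g2 x * Q x + dw g3 x * Q x + dwb g4 x * Q x
        + q x * of_real (\<rho> x) * Q x)"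
      by (simp only: set_integral_add set_integral_diff parts iq) simp
    finally have "(LINT x:Dom|lborel. dz g1 x * Q x + dzb g2 x * Q x + dw g3 x * Q x + dwb g4 x * Q x
        + q x * of_real (\<rho> x) * Q x) = 0" by simp
    moreover have "dz g1 x * Q x + dzb g2 x * Q x + dw g3 x * Q x + dwb g4 x * Q x
        + q x * of_real (\<rho> x) * Q x = of_real (P x) * E x" for x
      by (simp add: E_def Q_def algebra_simps)
    ultimately have "(LINT x:Dom|lborel. of_real (P x) * E x) = 0" by simp
    moreover have "P x \<ge> 0" for x by (simp add: P_def f_def g_def)
    moreover have "P x0 > 0"
      using e by (simp add: P_def f_def g_def u_def v_def z0_def w0_def a_def)
    ultimately show "\<exists>P :: complex \<times> complex \<Rightarrow> real.
      continuous_on UNIV P \<and> (\<forall>x. 0 \<le> P x) \<and> P x0 > 0 \<and> (\<forall>x. x \<notin> cball x0 d \<longrightarrow> P x = 0) \<and>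
      (LINT x:Dom|lborel. of_real (P x) * E x) = 0"
      using contP P0 by blast
  qed
  then show ?thesis by (simp add: E_def g_defs[abs_def])
qed

end

section \<open>The explicit weight\<close>

text \<open>The real gradient of n^p exp(-s/n), obtained by logarithmic differentiation. Each
  complex plane is treated as a Euclidean one, where the real part of z^2 cnj w is the inner product
  of z^2 and w.\<close>

definition weight_gradient :: "real \<Rightarrow> complex \<times> complex \<Rightarrow> complex \<times> complex" where
  "weight_gradient p x =
    (let z = fst x; w = snd x; n = 1 - w \<bullet> w; s = z \<bullet> z + (z * z) \<bullet> w in
     weight_solution p x *\<^sub>R
       (- (2 * z + 2 * cnj z * w) /\<^sub>R n, - ((2 * p / n) *\<^sub>R w) - (z * z) /\<^sub>R n - (2 * s / n\<^sup>2) *\<^sub>R w))"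

lemma weight_solution_inner:
  "weight_solution p x = (1 - snd x \<bullet> snd x) powr p *
     exp (- ((fst x \<bullet> fst x + (fst x * fst x) \<bullet> snd x) / (1 - snd x \<bullet> snd x)))"
proof -
  obtain z w where x: "x = (z, w)" by force
  have "Re (2 * of_real ((cmod z)\<^sup>2) + z\<^sup>2 * cnj w + (cnj z)\<^sup>2 * w)
      = 2 * (z \<bullet> z + (z * z) \<bullet> w)"
    unfolding power2_norm_eq_inner by (simp add: inner_complex_def power2_eq_square algebra_simps)
  then have "Re (2 * of_real ((cmod z)\<^sup>2) + z\<^sup>2 * cnj w + (cnj z)\<^sup>2 * w) / (2 * (1 - (cmod w)\<^sup>2))
      = (z \<bullet> z + (z * z) \<bullet> w) / (1 - w \<bullet> w)"
    by (simp only: power2_norm_eq_inner mult_divide_mult_cancel_left_if) simp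
  then have "Re ((2 * of_real ((cmod z)\<^sup>2) + z\<^sup>2 * cnj w + (cnj z)\<^sup>2 * w) / (2 * (1 - (cmod w)\<^sup>2)))
      = (z \<bullet> z + (z * z) \<bullet> w) / (1 - w \<bullet> w)"
    by (metis (no_types, opaque_lifting) Re_divide_of_real of_real_1 of_real_diff of_real_mult of_real_numeral of_real_power)
  then show ?thesis
    unfolding x weight_solution_def by (simp add: power2_norm_eq_inner)
qed

lemma Dom_inner: "x \<in> Dom \<longleftrightarrow> 1 - snd x \<bullet> snd x > 0"
  using power_less_one_iff[of "cmod (snd x)" 2]
  by (cases x) (auto simp: Dom_iff power2_norm_eq_inner[symmetric] abs_square_less_1)

lemma weight_solution_has_derivative:
  assumes "x \<in> Dom"
  shows "(weight_solution p has_derivative (\<lambda>h. weight_gradient p x \<bullet> h)) (at x)"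
proof -
  define n where "n y = 1 - snd y \<bullet> snd y" for y :: "complex \<times> complex"
  define s where "s y = fst y \<bullet> fst y + (fst y * fst y) \<bullet> snd y" for y :: "complex \<times> complex"
  have n: "n x > 0" using assms by (simp add: Dom_inner n_def)
  define n' where "n' h = - 2 * (snd x \<bullet> snd h)" for h :: "complex \<times> complex"
  define s' where "s' h = (2 * fst x + 2 * cnj (fst x) * snd x) \<bullet> fst h + (fst x * fst x) \<bullet> snd h"
    for h :: "complex \<times> complex"
  have dn: "(n has_derivative n') (at x)"
    unfolding n_def[abs_def] n'_def[abs_def] by (auto intro!: derivative_eq_intros simp: inner_commute)
  have ds: "(s has_derivative s') (at x)"
    unfolding s_def[abs_def] s'_def[abs_def]
    by (auto intro!: derivative_eq_intros simp: fun_eq_iff inner_complex_def algebra_simps)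
  have "((\<lambda>t. t powr p) has_real_derivative p * n x powr (p - 1)) (at (n x))"
    using n by (rule has_real_derivative_powr)
  from DERIV_compose_FDERIV[OF this dn]
  have d1: "((\<lambda>y. n y powr p) has_derivative (\<lambda>h. n' h * (p * n x powr (p - 1)))) (at x)" .
  have "((\<lambda>y. - (s y / n y)) has_derivative (\<lambda>h. - ((s' h * n x - s x * n' h) / (n x * n x)))) (at x)"
    using n by (intro has_derivative_minus has_derivative_divide'[OF ds dn]) auto
  from DERIV_compose_FDERIV[OF DERIV_exp this]
  have d2: "((\<lambda>y. exp (- (s y / n y))) has_derivative
      (\<lambda>h. - ((s' h * n x - s x * n' h) / (n x * n x)) * exp (- (s x / n x)))) (at x)" .
  have eq: "weight_solution p = (\<lambda>y. n y powr p * exp (- (s y / n y)))"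
    by (simp add: fun_eq_iff weight_solution_inner n_def s_def)
  have "n x powr p * (- ((s' h * n x - s x * n' h) / (n x * n x)) * exp (- (s x / n x)))
      + n' h * (p * n x powr (p - 1)) * exp (- (s x / n x)) = weight_gradient p x \<bullet> h" for h
  proof -
    \<comment> \<open>This makes the weight a common factor of all terms; what remains is its
      logarithmic derivative.\<close>
    have "n x powr (p - 1) = n x powr p / n x" using n by (simp add: powr_diff)
    then have "n x powr p * (- ((s' h * n x - s x * n' h) / (n x * n x)) * exp (- (s x / n x)))
      + n' h * (p * n x powr (p - 1)) * exp (- (s x / n x))
      = weight_solution p x * (p * n' h / n x - s' h / n x + s x * n' h / (n x)\<^sup>2)"
      using n by (simp add: eq field_simps power2_eq_square)
    also have "p * n' h / n x - s' h / n x + s x * n' h / (n x)\<^sup>2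
      = (- (2 * fst x + 2 * cnj (fst x) * snd x) /\<^sub>R n x) \<bullet> fst h
       + (- ((2 * p / n x) *\<^sub>R snd x) - (fst x * fst x) /\<^sub>R n x - (2 * s x / (n x)\<^sup>2) *\<^sub>R snd x) \<bullet> snd h"
      using n by (simp add: n'_def s'_def inner_simps divide_simps) (simp add: algebra_simps)
    finally show ?thesis
      by (simp add: weight_gradient_def Let_def n_def s_def inner_prod_def inner_simps distrib_left)
  qed
  with has_derivative_mult[OF d1 d2] show ?thesis by (simp add: eq)
qed

lemma continuous_on_weight_solution: "continuous_on Dom (weight_solution p)"
  by (intro continuous_at_imp_continuous_on ballI has_derivative_continuous[OF weight_solution_has_derivative])

lemma continuous_on_weight_gradient: "continuous_on Dom (weight_gradient p)"
proof -
  have "1 - snd x \<bullet> snd x \<noteq> 0" if "x \<in> Dom" for x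
    using that Dom_inner[of x] by simp
  then show ?thesis
    unfolding weight_gradient_def[abs_def] Let_def
    by (intro continuous_intros continuous_on_weight_solution) auto
qed

lemma C1_on_Dom_weight_solution: "C1_on_Dom (weight_solution p)"
  unfolding C1_on_Dom_def
proof (intro exI conjI ballI)
  show "continuous_on Dom (\<lambda>x. blinfun_inner_right (weight_gradient p x))"
    by (rule bounded_linear.continuous_on[OF bounded_linear_blinfun_inner_right continuous_on_weight_gradient])
  show "(weight_solution p has_derivative blinfun_apply (blinfun_inner_right (weight_gradient p x))) (at x)"
    if "x \<in> Dom" for x
    using weight_solution_has_derivative[OF that] by simp
qed

text \<open>The gradient of a real function, read as the complex number f_x + i f_y, is twice its
  derivative in the conjugate variable; conjugation gives the other one.\<close>

lemma wirtinger_gradient: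
  assumes "(f has_derivative (\<lambda>h. G \<bullet> h)) (at x)"
  shows "dz (\<lambda>x. complex_of_real (f x)) x = cnj (fst G) / 2" "dzb (\<lambda>x. complex_of_real (f x)) x = fst G / 2"
    "dw (\<lambda>x. complex_of_real (f x)) x = cnj (snd G) / 2" "dwb (\<lambda>x. complex_of_real (f x)) x = snd G / 2"
  unfolding wirtinger_simps wirtinger_eq[OF has_derivative_of_real[OF assms]]
  by (auto simp: complex_eq_iff inner_prod_def inner_complex_def)

text \<open>All derivatives are the weight times a rational function, so after removing this factor
  the equations are algebraic identities in z, w and their conjugates.\<close>

lemma weight_equations_weight_solution: "weight_equations p (weight_solution p)"
  unfolding weight_equations_def Let_def
proof (rule ballI, clarify)
  fix z w assume x: "(z, w) \<in> Dom"
  \<comment> \<open>The conjugates get names of their own so that the algebra treats them as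
    independent variables; \<open>n\<close> and \<open>s\<close> are eliminated only where their
    defining relations are needed.\<close>
  define n s r zc wc where "n = complex_of_real (1 - w \<bullet> w)" and "s = complex_of_real (z \<bullet> z + (z * z) \<bullet> w)"
    and "r = complex_of_real (weight_solution p (z, w))" and "zc = cnj z" and "wc = cnj w"
  have n0: "n \<noteq> 0" using Dom_inner[of "(z, w)"] x by (auto simp: n_def)
  have n: "n = 1 - w * wc"
    by (simp add: n_def wc_def complex_eq_iff inner_complex_def)
  have s: "2 * s = 2 * z * zc + z * z * wc + zc * zc * w"
    by (simp add: s_def zc_def wc_def complex_eq_iff inner_complex_def algebra_simps)
  note d = wirtinger_gradient[OF weight_solution_has_derivative[OF x, of p]]
  have G: "fst (weight_gradient p (z, w)) = - r * (2 * z + 2 * zc * w) / n"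
    "snd (weight_gradient p (z, w)) = r * (- (2 * of_real p * w / n) - z * z / n - 2 * s * w / n\<^sup>2)"
    unfolding n_def s_def r_def zc_def
    by (simp_all add: weight_gradient_def Let_def scaleR_conv_of_real divide_inverse algebra_simps)
  have real: "cnj n = n" "cnj s = s" "cnj r = r"
    by (simp_all add: n_def s_def r_def)
  have D: "dz (\<lambda>x. complex_of_real (weight_solution p x)) (z, w) = - r * (zc + z * wc) / n"
    "dzb (\<lambda>x. complex_of_real (weight_solution p x)) (z, w) = - r * (z + zc * w) / n"
    "dw (\<lambda>x. complex_of_real (weight_solution p x)) (z, w)
      = - r * (of_real p * wc / n + zc * zc / (2 * n) + s * wc / n\<^sup>2)"
    "dwb (\<lambda>x. complex_of_real (weight_solution p x)) (z, w)
      = - r * (of_real p * w / n + z * z / (2 * n) + s * w / n\<^sup>2)"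
    unfolding d G using n0 by (simp_all add: real zc_def wc_def field_simps)
  show "w * dz (\<lambda>x. complex_of_real (weight_solution p x)) (z, w) - dzb (\<lambda>x. complex_of_real (weight_solution p x)) (z, w)
      = z * complex_of_real (weight_solution p (z, w)) \<and>
    w\<^sup>2 * dw (\<lambda>x. complex_of_real (weight_solution p x)) (z, w) - dwb (\<lambda>x. complex_of_real (weight_solution p x)) (z, w)
      = (z\<^sup>2 / 2 + complex_of_real p * w) * complex_of_real (weight_solution p (z, w))
        - z * w * dz (\<lambda>x. complex_of_real (weight_solution p x)) (z, w) \<and>
    2 * (w * dw (\<lambda>x. complex_of_real (weight_solution p x)) (z, w)
         - cnj w * dwb (\<lambda>x. complex_of_real (weight_solution p x)) (z, w))
      = cnj z * dzb (\<lambda>x. complex_of_real (weight_solution p x)) (z, w)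
        - z * dz (\<lambda>x. complex_of_real (weight_solution p x)) (z, w)"
    unfolding D r_def[symmetric] zc_def[symmetric] wc_def[symmetric]
  proof (intro conjI)
    \<comment> \<open>The terms with \<open>zc\<close> cancel, and the remaining factor 1 - w * wc
      is \<open>n\<close> itself, which removes the denominator.\<close>
    have "w * (- r * (zc + z * wc) / n) - - r * (z + zc * w) / n = z * r * (1 - w * wc) / n"
      using n0 by (simp add: field_simps)
    then show "w * (- r * (zc + z * wc) / n) - - r * (z + zc * w) / n = z * r"
      unfolding n[symmetric] using n0 by simp
    show "2 * (w * (- r * (of_real p * wc / n + zc * zc / (2 * n) + s * wc / n\<^sup>2))
       - wc * (- r * (of_real p * w / n + z * z / (2 * n) + s * w / n\<^sup>2)))
      = zc * (- r * (z + zc * w) / n) - z * (- r * (zc + z * wc) / n)"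
      using n0 by (simp add: field_simps power2_eq_square)
    have "w\<^sup>2 * (- r * (of_real p * wc / n + zc * zc / (2 * n) + s * wc / n\<^sup>2))
        - - r * (of_real p * w / n + z * z / (2 * n) + s * w / n\<^sup>2)
      = r * (of_real p * w * (1 - w * wc) / n + (z * z - w * w * zc * zc) / (2 * n) + s * w * (1 - w * wc) / n\<^sup>2)"
      using n0 by (simp add: field_simps power2_eq_square)
    also have "\<dots> = r * (of_real p * w + (z * z - w * w * zc * zc + 2 * s * w) / (2 * n))"
      unfolding n[symmetric] using n0 by (simp add: field_simps power2_eq_square)
    \<comment> \<open>The crux of the second equation: the part of 2sw quadratic in
      \<open>zc\<close> cancels, and the rest splits into a multiple of \<open>n\<close> and the
      term that z w d/dz produces.\<close>
    also have "z * z - w * w * zc * zc + 2 * s * w = z * z * n + 2 * z * w * (zc + z * wc)"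
      unfolding s n by (simp add: algebra_simps)
    also have "r * (of_real p * w + (z * z * n + 2 * z * w * (zc + z * wc)) / (2 * n))
       = (z\<^sup>2 / 2 + of_real p * w) * r - z * w * (- r * (zc + z * wc) / n)"
      using n0 by (simp add: field_simps power2_eq_square)
    finally show "w\<^sup>2 * (- r * (of_real p * wc / n + zc * zc / (2 * n) + s * wc / n\<^sup>2))
        - - r * (of_real p * w / n + z * z / (2 * n) + s * w / n\<^sup>2)
      = (z\<^sup>2 / 2 + of_real p * w) * r - z * w * (- r * (zc + z * wc) / n)" .
  qed
qed

section \<open>Weights satisfying the adjointness relations\<close>

definition zw_power :: "nat \<Rightarrow> nat \<Rightarrow> complex \<times> complex \<Rightarrow> complex" where
  "zw_power m n = (\<lambda>(z, w). z ^ m * w ^ n)"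

lemma zw_power_apply: "zw_power m n x = fst x ^ m * snd x ^ n"
  by (simp add: zw_power_def case_prod_beta)

lemma tame_zw_power: "tame (zw_power m n)"
  unfolding zw_power_apply[abs_def] by (intro tame_intros)

lemma zw_power_has_derivative:
  "(zw_power m n has_derivative (\<lambda>h. of_nat m * zw_power (m - 1) n x * fst h
     + of_nat n * zw_power m (n - 1) x * snd h)) (at x)"
  unfolding zw_power_apply[abs_def]
  by (auto intro!: derivative_eq_intros simp: algebra_simps)

lemma dz_zw_power: "dz (zw_power m n) x = of_nat m * zw_power (m - 1) n x"
  and dw_zw_power: "dw (zw_power m n) x = of_nat n * zw_power m (n - 1) x"
  unfolding wirtinger_simps wirtinger_eq[OF zw_power_has_derivative]
  by (simp_all add: field_simps)

lemma op_zw_power: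
  "op_a (zw_power m n) = (\<lambda>x. of_nat m * zw_power (m - 1) n x)"
  "op_adag (zw_power m n) = (\<lambda>x. zw_power (Suc m) n x + of_nat m * zw_power (m - 1) (Suc n) x)"
  "op_Kminus (zw_power m n) = (\<lambda>x. of_nat n * zw_power m (n - 1) x)"
  "op_K0 k (zw_power m n) = (\<lambda>x. (of_real k + of_nat m / 2 + of_nat n) * zw_power m n x)"
  "op_Kplus k (zw_power m n) = (\<lambda>x. 1 / 2 * zw_power (Suc (Suc m)) n x
     + (2 * of_real k + of_nat m + of_nat n) * zw_power m (Suc n) x)"
proof -
  show "op_a (zw_power m n) = (\<lambda>x. of_nat m * zw_power (m - 1) n x)"
    "op_Kminus (zw_power m n) = (\<lambda>x. of_nat n * zw_power m (n - 1) x)"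
    by (auto simp: op_a_def op_Kminus_def dz_zw_power dw_zw_power fun_eq_iff)
  show "op_adag (zw_power m n) = (\<lambda>x. zw_power (Suc m) n x + of_nat m * zw_power (m - 1) (Suc n) x)"
    by (auto simp: op_adag_def dz_zw_power zw_power_apply fun_eq_iff algebra_simps)
  show "op_K0 k (zw_power m n) = (\<lambda>x. (of_real k + of_nat m / 2 + of_nat n) * zw_power m n x)"
    \<comment> \<open>Multiplication by z restores the lowered power only for m > 0; for m = 0 the
      factor m makes the term vanish. The same holds for w and n.\<close>
    by (cases m; cases n) (auto simp: op_K0_def dz_zw_power dw_zw_power zw_power_apply fun_eq_iff field_simps)
  show "op_Kplus k (zw_power m n) = (\<lambda>x. 1 / 2 * zw_power (Suc (Suc m)) n x
     + (2 * of_real k + of_nat m + of_nat n) * zw_power m (Suc n) x)"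
    by (cases m; cases n)
      (auto simp: op_Kplus_def dz_zw_power dw_zw_power zw_power_apply fun_eq_iff power2_eq_square algebra_simps)
qed

section \<open>Holomorphic functions of finite norm\<close>

lemma holomorphic2_iff:
  "holomorphic2 f \<longleftrightarrow> (\<forall>x\<in>Dom. \<exists>A B. (f has_derivative (\<lambda>h. A * fst h + B * snd h)) (at x))"
  by (simp add: holomorphic2_def case_prod_unfold)

lemma holomorphic2_continuous_on: "holomorphic2 f \<Longrightarrow> continuous_on Dom f"
  unfolding holomorphic2_def by (intro continuous_at_imp_continuous_on ballI) (blast dest: has_derivative_continuous)

lemma holomorphic2_add:
  assumes "holomorphic2 f" and "holomorphic2 g"
  shows "holomorphic2 (\<lambda>x. f x + g x)"
  unfolding holomorphic2_iff
proof
  fix x assume x: "x \<in> Dom"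
  obtain A B where f: "(f has_derivative (\<lambda>h. A * fst h + B * snd h)) (at x)"
    using assms(1) x unfolding holomorphic2_iff by blast
  obtain A' B' where g: "(g has_derivative (\<lambda>h. A' * fst h + B' * snd h)) (at x)"
    using assms(2) x unfolding holomorphic2_iff by blast
  have "((\<lambda>x. f x + g x) has_derivative (\<lambda>h. (A + A') * fst h + (B + B') * snd h)) (at x)"
    using has_derivative_add[OF f g] by (simp add: algebra_simps)
  then show "\<exists>A B. ((\<lambda>x. f x + g x) has_derivative (\<lambda>h. A * fst h + B * snd h)) (at x)" by blast
qed

lemma holomorphic2_cmult:
  assumes "holomorphic2 f"
  shows "holomorphic2 (\<lambda>x. c * f x)"
  unfolding holomorphic2_iff
proof
  fix x assume x: "x \<in> Dom"
  obtain A B where f: "(f has_derivative (\<lambda>h. A * fst h + B * snd h)) (at x)"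
    using assms(1) x unfolding holomorphic2_iff by blast
  have "((\<lambda>x. c * f x) has_derivative (\<lambda>h. (c * A) * fst h + (c * B) * snd h)) (at x)"
    using has_derivative_mult_right[OF f, of c] by (simp add: algebra_simps)
  then show "\<exists>A B. ((\<lambda>x. c * f x) has_derivative (\<lambda>h. A * fst h + B * snd h)) (at x)" by blast
qed

lemma hol_L2_cmult: "f \<in> hol_L2 \<rho> \<Longrightarrow> (\<lambda>x. c * f x) \<in> hol_L2 \<rho>"
  using set_integrable_mult_right[of "(cmod c)\<^sup>2" lborel Dom "\<lambda>x. (cmod (f x))\<^sup>2 * \<rho> x"]
  by (auto simp: hol_L2_def norm_mult power_mult_distrib mult.assoc intro: holomorphic2_cmult)

text \<open>The majorant is |f + g|^2 \<le> 2 |f|^2 + 2 |g|^2; absolute values appear because \<rho>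
  may be negative.\<close>

lemma hol_L2_add:
  assumes "continuous_on Dom \<rho>" and "f \<in> hol_L2 \<rho>" and "g \<in> hol_L2 \<rho>"
  shows "(\<lambda>x. f x + g x) \<in> hol_L2 \<rho>"
proof -
  let ?F = "\<lambda>x. (cmod (f x))\<^sup>2 * \<rho> x" and ?G = "\<lambda>x. (cmod (g x))\<^sup>2 * \<rho> x"
  have h: "holomorphic2 f" "holomorphic2 g" and F: "set_integrable lborel Dom ?F" and G: "set_integrable lborel Dom ?G"
    using assms by (auto simp: hol_L2_def)
  have "set_integrable lborel Dom (\<lambda>x. (cmod (f x + g x))\<^sup>2 * \<rho> x)"
  proof (rule set_integrable_bound)
    show "set_integrable lborel Dom (\<lambda>x. 2 * \<bar>?F x\<bar> + 2 * \<bar>?G x\<bar>)"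
      using set_integrable_abs[OF F] set_integrable_abs[OF G]
      by (intro set_integral_add set_integrable_mult_right) auto
    show "set_borel_measurable lborel Dom (\<lambda>x. (cmod (f x + g x))\<^sup>2 * \<rho> x)"
      by (intro set_borel_measurable_continuous_on_Dom continuous_intros assms(1)
          holomorphic2_continuous_on[OF h(1)] holomorphic2_continuous_on[OF h(2)])
    have "(cmod (f x + g x))\<^sup>2 \<le> 2 * (cmod (f x))\<^sup>2 + 2 * (cmod (g x))\<^sup>2" for x
    proof -
      have "(cmod (f x + g x))\<^sup>2 \<le> (cmod (f x) + cmod (g x))\<^sup>2"
        by (intro power_mono norm_triangle_ineq) auto
      also have "\<dots> \<le> 2 * (cmod (f x))\<^sup>2 + 2 * (cmod (g x))\<^sup>2"
        using zero_le_power2[of "cmod (f x) - cmod (g x)"] by (simp add: power2_eq_square algebra_simps)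
      finally show ?thesis .
    qed
    from mult_right_mono[OF this abs_ge_zero]
    have "\<bar>(cmod (f x + g x))\<^sup>2 * \<rho> x\<bar> \<le> \<bar>2 * \<bar>?F x\<bar> + 2 * \<bar>?G x\<bar>\<bar>" for x
      by (simp add: abs_mult algebra_simps)
    then show "AE x in lborel. x \<in> Dom \<longrightarrow> norm ((cmod (f x + g x))\<^sup>2 * \<rho> x) \<le> norm (2 * \<bar>?F x\<bar> + 2 * \<bar>?G x\<bar>)"
      by simp
  qed
  then show ?thesis by (simp add: hol_L2_def holomorphic2_add h)
qed

text \<open>\<open>sign\<close> expresses that the scalar product is positive: for 4k < 3 the weight
  is nonpositive, and only its product with the prefactor has a fixed sign.\<close>

locale adjoint_weight =
  fixes k :: real and \<rho> :: "complex \<times> complex \<Rightarrow> real"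
  assumes k: "4 * k \<noteq> 3" and C1: "C1_on_Dom \<rho>"
    and sign: "\<And>x. x \<in> Dom \<Longrightarrow> 0 \<le> (4 * k - 3) * \<rho> x"
    and zw: "\<And>m n. zw_power m n \<in> hol_L2 \<rho>"
    and adj_a: "adjoint_cond k \<rho> op_a op_adag"
    and adj_K: "adjoint_cond k \<rho> op_Kminus (op_Kplus k)"
    and adj_0: "adjoint_cond k \<rho> (op_K0 k) (op_K0 k)"
begin

lemma cont: "continuous_on Dom \<rho>"
  using C1 unfolding C1_on_Dom_def
  by (auto intro!: continuous_at_imp_continuous_on dest: has_derivative_continuous)

lemma C1_with_complex: "\<exists>r'. C1_with (\<lambda>x. complex_of_real (\<rho> x)) r'"
proof -
  obtain d :: "complex \<times> complex \<Rightarrow> (complex \<times> complex) \<Rightarrow>\<^sub>L real" where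
    d: "\<And>x. x \<in> Dom \<Longrightarrow> (\<rho> has_derivative blinfun_apply (d x)) (at x)" "continuous_on Dom d"
    using C1 unfolding C1_on_Dom_def by blast
  have c: "C1_with (\<lambda>x. complex_of_real (\<rho> x)) (\<lambda>x h. complex_of_real (blinfun_apply (d x) h))"
    unfolding C1_with_def
    by (intro conjI ballI allI has_derivative_of_real d continuous_intros)
  show ?thesis by (rule exI, rule c)
qed

text \<open>Each operator maps a monomial to a combination of at most two monomials, so monomials
  belong to all the maximal domains in \<open>adjoint_cond\<close>.\<close>

lemma ops_hol_L2:
  "op_a (zw_power m n) \<in> hol_L2 \<rho>" "op_adag (zw_power m n) \<in> hol_L2 \<rho>"
  "op_Kminus (zw_power m n) \<in> hol_L2 \<rho>" "op_Kplus k (zw_power m n) \<in> hol_L2 \<rho>"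
  "op_K0 k (zw_power m n) \<in> hol_L2 \<rho>"
  unfolding op_zw_power by (intro hol_L2_add[OF cont] hol_L2_cmult zw)+

lemma adjoint_integral:
  assumes "adjoint_cond k \<rho> A B" and "f \<in> hol_L2 \<rho>" "g \<in> hol_L2 \<rho>" "A f \<in> hol_L2 \<rho>" "B g \<in> hol_L2 \<rho>"
  shows "(LINT x:Dom|lborel. cnj (A f x) * g x * of_real (\<rho> x)) = (LINT x:Dom|lborel. cnj (f x) * B g x * of_real (\<rho> x))"
proof -
  have "(4 * k - 3) / (2 * pi\<^sup>2) \<noteq> 0" using k by simp
  then have "complex_of_real ((4 * k - 3) / (2 * pi\<^sup>2)) \<noteq> 0" by (simp only: of_real_eq_0_iff not_False_eq_True)
  moreover have "scalar_prod k \<rho> (A f) g = scalar_prod k \<rho> f (B g)"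
    using assms unfolding adjoint_cond_def by blast
  ultimately show ?thesis unfolding scalar_prod_def by (simp only: mult_cancel_left) simp
qed

section \<open>Moments of the weight and Gaussian integrability\<close>

definition moment :: "nat \<Rightarrow> real" where
  "moment n = (LINT x:Dom|lborel. cmod (fst x) ^ (2 * n) * \<bar>\<rho> x\<bar>)"

lemma moment_integrable: "set_integrable lborel Dom (\<lambda>x. cmod (fst x) ^ (2 * n) * \<bar>\<rho> x\<bar>)"
proof -
  have "set_integrable lborel Dom (\<lambda>x. (cmod (zw_power n 0 x))\<^sup>2 * \<rho> x)"
    using zw by (simp add: hol_L2_def)
  from set_integrable_abs[OF this] show ?thesis
    by (simp add: zw_power_apply norm_power abs_mult power_mult[symmetric] mult.commute)
qed

lemma moment_nonneg: "moment n \<ge> 0"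
  unfolding moment_def set_lebesgue_integral_def by (intro Bochner_Integration.integral_nonneg) auto

lemma integrable_moment_bound:
  fixes P :: "complex \<times> complex \<Rightarrow> complex"
  assumes "continuous_on Dom P" and "\<And>x. x \<in> Dom \<Longrightarrow> cmod (P x) \<le> cmod (fst x) ^ (2 * n)"
  shows "set_integrable lborel Dom (\<lambda>x. P x * of_real (\<rho> x))"
    and "cmod (LINT x:Dom|lborel. P x * of_real (\<rho> x)) \<le> moment n"
proof -
  have le: "cmod (P x * of_real (\<rho> x)) \<le> cmod (fst x) ^ (2 * n) * \<bar>\<rho> x\<bar>" if "x \<in> Dom" for x
    using assms(2)[OF that] by (simp add: norm_mult mult_right_mono)
  show i: "set_integrable lborel Dom (\<lambda>x. P x * of_real (\<rho> x))"
  proof (rule set_integrable_bound[OF moment_integrable[of n]])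
    show "set_borel_measurable lborel Dom (\<lambda>x. P x * complex_of_real (\<rho> x))"
      by (intro set_borel_measurable_continuous_on_Dom continuous_intros assms cont)
  qed (use le in auto)
  have "cmod (LINT x:Dom|lborel. P x * of_real (\<rho> x)) \<le> (LINT x:Dom|lborel. cmod (P x * of_real (\<rho> x)))"
    by (rule set_integral_norm_bound[OF i])
  also have "\<dots> \<le> moment n"
    unfolding moment_def
    by (rule set_integral_mono[OF set_integrable_norm[OF i] moment_integrable]) (rule le)
  finally show "cmod (LINT x:Dom|lborel. P x * of_real (\<rho> x)) \<le> moment n" .
qed

text \<open>Adjointness of a with f = z^(m+1) and g = z^m gives (m+1) (z^m, z^m) = (z^(m+1),
  z^(m+1)) + m (z^(m+1), w z^(m-1)). The last term has total degree 2m in z and |w| < 1, so it costs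
  at most m times the m-th moment.\<close>

lemma moment_Suc: "moment (Suc m) \<le> 2 * real (Suc m) * moment m"
proof -
  define J where "J P = (LINT x:Dom|lborel. P x * complex_of_real (\<rho> x))" for P :: "complex \<times> complex \<Rightarrow> complex"
  define Q where "Q x = cnj (fst x) ^ Suc m * (of_nat m * zw_power (m - 1) (Suc 0) x)" for x
  define N where "N n x = cnj (fst x) ^ n * fst x ^ n" for n and x :: "complex \<times> complex"
  have N: "N n x = of_real (cmod (fst x) ^ (2 * n))" for n x
  proof -
    have "N n x = of_real ((cmod (fst x))\<^sup>2) ^ n"
      by (simp only: complex_norm_square power_mult_distrib N_def mult.commute)
    then show ?thesis by (simp add: power_mult)
  qed
  have cN: "continuous_on Dom (N n)" for n unfolding N_def[abs_def] by (intro continuous_intros)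
  have cZ: "continuous_on Dom (zw_power m n)" for m n by (intro tame_continuous tame_zw_power)
  have iN: "set_integrable lborel Dom (\<lambda>x. N n x * of_real (\<rho> x))" for n
    by (rule integrable_moment_bound(1)[of "N n" n, OF cN]) (simp add: N norm_power)
  have JN: "cmod (J (N n)) = moment n" for n
  proof -
    \<comment> \<open>The constant sign of \<rho> excludes cancellation: the modulus of the integral
      against \<rho> is the integral against its absolute value.\<close>
    have r: "\<bar>\<rho> x\<bar> = sgn (4 * k - 3) * \<rho> x" if "x \<in> Dom" for x
      using sign[OF that] k by (auto simp: sgn_if abs_if zero_le_mult_iff split: if_splits)
    have "moment n = (LINT x:Dom|lborel. sgn (4 * k - 3) * (cmod (fst x) ^ (2 * n) * \<rho> x))"
      unfolding moment_def by (rule set_lebesgue_integral_cong) (auto simp: r)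
    also have "\<dots> = sgn (4 * k - 3) * (LINT x:Dom|lborel. cmod (fst x) ^ (2 * n) * \<rho> x)"
      by (rule set_integral_mult_right)
    finally have "\<bar>moment n\<bar> = \<bar>LINT x:Dom|lborel. cmod (fst x) ^ (2 * n) * \<rho> x\<bar>"
      using k by (simp add: abs_mult)
    moreover have "J (N n) = of_real (LINT x:Dom|lborel. cmod (fst x) ^ (2 * n) * \<rho> x)"
      unfolding J_def N set_integral_complex_of_real[symmetric] by simp
    ultimately show ?thesis using moment_nonneg[of n] by simp
  qed
  \<comment> \<open>For m = 0 the truncated \<open>m - 1\<close> would spoil the degree count (m +
    1) + (m - 1) = 2m; that case is separate, with \<open>Q\<close> zero because of its factor
    m.\<close>
  have Qb: "cmod (cnj (fst x) ^ Suc m * zw_power (m - 1) (Suc 0) x) \<le> cmod (fst x) ^ (2 * m)"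
    if "x \<in> Dom" "m \<noteq> 0" for x
  proof -
    have e: "Suc m + (m - 1) = 2 * m" using that by simp
    have "cmod (cnj (fst x) ^ Suc m * zw_power (m - 1) (Suc 0) x)
        = cmod (fst x) ^ (Suc m + (m - 1)) * cmod (snd x)"
      unfolding power_add by (simp add: zw_power_apply norm_mult norm_power)
    also have "\<dots> \<le> cmod (fst x) ^ (2 * m) * 1"
      unfolding e using that by (intro mult_left_mono) (auto simp: Dom_def)
    finally show ?thesis by simp
  qed
  have Q: "set_integrable lborel Dom (\<lambda>x. Q x * of_real (\<rho> x)) \<and> cmod (J Q) \<le> real m * moment m"
  proof (cases "m = 0")
    case True
    then show ?thesis by (simp add: Q_def J_def set_integrable_def)
  next
    case False
    let ?P = "\<lambda>x. cnj (fst x) ^ Suc m * zw_power (m - 1) (Suc 0) x"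
    have cP: "continuous_on Dom ?P" by (intro continuous_intros cZ)
    note b = integrable_moment_bound[OF cP Qb[OF _ False]]
    have eq: "Q x * of_real (\<rho> x) = of_nat m * (?P x * of_real (\<rho> x))" for x
      by (simp add: Q_def)
    have "J Q = of_nat m * J ?P"
      unfolding J_def eq by (rule set_integral_mult_right)
    then show ?thesis
      unfolding eq using set_integrable_mult_right[OF b(1)] b(2)
      by (simp add: J_def norm_mult mult_left_mono)
  qed
  have l: "cnj (op_a (zw_power (Suc m) 0) x) * zw_power m 0 x * of_real (\<rho> x)
      = of_nat (Suc m) * (N m x * of_real (\<rho> x))" for x
    by (simp add: op_zw_power zw_power_apply N_def algebra_simps)
  have r: "cnj (zw_power (Suc m) 0 x) * op_adag (zw_power m 0) x * of_real (\<rho> x)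
      = N (Suc m) x * of_real (\<rho> x) + Q x * of_real (\<rho> x)" for x
    by (simp add: op_zw_power zw_power_apply N_def Q_def algebra_simps)
  have "of_nat (Suc m) * J (N m)
      = (LINT x:Dom|lborel. cnj (op_a (zw_power (Suc m) 0) x) * zw_power m 0 x * of_real (\<rho> x))"
    unfolding l J_def by (rule set_integral_mult_right[symmetric])
  also have "\<dots> = (LINT x:Dom|lborel. cnj (zw_power (Suc m) 0 x) * op_adag (zw_power m 0) x * of_real (\<rho> x))"
    by (rule adjoint_integral[OF adj_a]) (rule zw ops_hol_L2)+
  also have "\<dots> = J (N (Suc m)) + J Q"
    unfolding r J_def by (rule set_integral_add(2)[OF iN conjunct1[OF Q]])
  finally have "of_nat (Suc m) * J (N m) = J (N (Suc m)) + J Q" .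
  then have "J (N (Suc m)) = of_nat (Suc m) * J (N m) - J Q" by simp
  then have "cmod (J (N (Suc m))) \<le> real (Suc m) * cmod (J (N m)) + cmod (J Q)"
    by (metis norm_mult norm_of_nat norm_triangle_ineq4)
  also have "\<dots> \<le> real (Suc m) * moment m + real m * moment m" using Q by (simp add: JN)
  also have "\<dots> \<le> 2 * real (Suc m) * moment m" using moment_nonneg[of m] by (simp add: algebra_simps)
  finally show ?thesis by (simp add: JN)
qed

lemma moment_le: "moment n \<le> 2 ^ n * fact n * moment 0"
proof (induction n)
  case (Suc n)
  have "moment (Suc n) \<le> 2 * real (Suc n) * (2 ^ n * fact n * moment 0)"
    by (rule order_trans[OF moment_Suc mult_left_mono[OF Suc]]) simp
  then show ?case by (simp add: algebra_simps)
qed simp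

text \<open>Summing the exponential series term by term, the coefficient 1 / (4^i i!) meets the
  moment bound 2^i i!, which leaves a geometric series of ratio 1/2.\<close>

lemma gaussian_integrable: "set_integrable lborel Dom (\<lambda>x. exp ((cmod (fst x))\<^sup>2 / 4) * \<rho> x)"
proof -
  define F where "F i x = (1 / (4 ^ i * fact i)) * (indicator Dom x *\<^sub>R (cmod (fst x) ^ (2 * i) * \<bar>\<rho> x\<bar>))"
    for i :: nat and x
  have F: "(\<lambda>i. F i x) sums (indicator Dom x *\<^sub>R (exp ((cmod (fst x))\<^sup>2 / 4) * \<bar>\<rho> x\<bar>))" for x
  proof -
    have "(\<lambda>i. ((cmod (fst x))\<^sup>2 / 4) ^ i /\<^sub>R fact i) sums exp ((cmod (fst x))\<^sup>2 / 4)"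
      by (rule exp_converges)
    note sm = sums_mult2[OF this, of "indicator Dom x * \<bar>\<rho> x\<bar>"]
    have e: "cmod (fst x) ^ (2 * i) = ((cmod (fst x))\<^sup>2) ^ i" for i by (rule power_mult)
    show ?thesis using sm by (simp only: F_def e) (simp add: power_divide field_simps)
  qed
  have iF: "integrable lborel (F i)" for i
    unfolding F_def using moment_integrable[of i] unfolding set_integrable_def
    by (intro integrable_mult_right)
  have intF: "(\<integral>x. norm (F i x) \<partial>lborel) = 1 / (4 ^ i * fact i) * moment i" for i
  proof -
    have "norm (F i x) = F i x" for x by (simp add: F_def)
    then show ?thesis
      using moment_integrable[of i] by (simp add: F_def[abs_def] moment_def set_lebesgue_integral_def)
  qed
  have "integrable lborel (\<lambda>x. \<Sum>i. F i x)"
  proof (rule integrable_suminf[OF iF])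
    show "AE x in lborel. summable (\<lambda>i. norm (F i x))"
    proof (rule AE_I2)
      fix x
      have "norm (F i x) = F i x" for i by (simp add: F_def)
      then show "summable (\<lambda>i. norm (F i x))" using F[of x] by (simp add: sums_iff)
    qed
    show "summable (\<lambda>i. \<integral>x. norm (F i x) \<partial>lborel)"
    proof (rule summable_comparison_test')
      show "summable (\<lambda>i. (1 / 2) ^ i * moment 0)" by (intro summable_mult2 summable_geometric) simp
      fix i :: nat
      have "1 / (4 ^ i * fact i) * moment i \<le> 1 / (4 ^ i * fact i) * (2 ^ i * fact i * moment 0)"
        by (intro mult_left_mono moment_le) simp
      also have "\<dots> = (1 / 2) ^ i * moment 0"
        using power_mult_distrib[of 2 "2::real" i] by (simp add: field_simps power_divide)
      finally show "norm (\<integral>x. norm (F i x) \<partial>lborel) \<le> (1 / 2) ^ i * moment 0"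
        unfolding intF using moment_nonneg[of i] by simp
    qed
  qed
  then have "set_integrable lborel Dom (\<lambda>x. exp ((cmod (fst x))\<^sup>2 / 4) * \<bar>\<rho> x\<bar>)"
    using F unfolding set_integrable_def by (simp add: sums_iff)
  then show ?thesis
  proof (rule set_integrable_bound)
    show "set_borel_measurable lborel Dom (\<lambda>x. exp ((cmod (fst x))\<^sup>2 / 4) * \<rho> x)"
      by (intro set_borel_measurable_continuous_on_Dom continuous_intros cont) auto
  qed (simp add: abs_mult)
qed

text \<open>The choice f = z^b w^d, g = z^a w^c reaches every mixed monomial. In \<open>eq\<close>
  the operator A contributes the conjugate derivatives and B the holomorphic ones, with its
  multiplication part in \<open>q\<close>.\<close>

lemma weak_equation_from_adjoint:
  assumes adj: "adjoint_cond k \<rho> A B"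
    and L2: "\<And>m n. A (zw_power m n) \<in> hol_L2 \<rho>" "\<And>m n. B (zw_power m n) \<in> hol_L2 \<rho>"
    and tameAB: "\<And>m n. tame (A (zw_power m n))" "\<And>m n. tame (B (zw_power m n))"
    and tame: "tame \<xi>1" "tame \<xi>2" "tame \<xi>3" "tame \<xi>4" "tame q"
    and eq: "\<And>a b c d x. mon_deriv \<xi>1 \<xi>2 \<xi>3 \<xi>4 a b c d x - q x * mon a b c d x
      = cnj (A (zw_power b d) x) * zw_power a c x - cnj (zw_power b d x) * B (zw_power a c) x"
  shows "weak_equation \<rho> \<xi>1 \<xi>2 \<xi>3 \<xi>4 q"
proof
  fix a b c d
  note i = tame_set_integrable[OF cont gaussian_integrable]
  let ?f = "zw_power b d" and ?g = "zw_power a c"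
  have "(LINT x:Dom|lborel. (mon_deriv \<xi>1 \<xi>2 \<xi>3 \<xi>4 a b c d x - q x * mon a b c d x) * complex_of_real (\<rho> x))
      = (LINT x:Dom|lborel. cnj (A ?f x) * ?g x * complex_of_real (\<rho> x) - cnj (?f x) * B ?g x * complex_of_real (\<rho> x))"
    unfolding eq by (simp add: left_diff_distrib)
  also have "\<dots> = (LINT x:Dom|lborel. cnj (A ?f x) * ?g x * complex_of_real (\<rho> x))
      - (LINT x:Dom|lborel. cnj (?f x) * B ?g x * complex_of_real (\<rho> x))"
    by (intro set_integral_diff(2) i tame_intros tameAB tame_zw_power)
  also have "\<dots> = 0"
    using adjoint_integral[OF adj zw zw L2] by simp
  finally show "(LINT x:Dom|lborel. (mon_deriv \<xi>1 \<xi>2 \<xi>3 \<xi>4 a b c d x - q x * mon a b c d x) * complex_of_real (\<rho> x)) = 0" .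
qed (fact cont gaussian_integrable tame)+

end

section \<open>The three equations for the weight\<close>

lemma wirtinger_mult_C1:
  assumes "C1_with f f'" and "C1_with g g'" and "x \<in> Dom"
  shows "wirtinger a b c (\<lambda>x. f x * g x) x = f x * wirtinger a b c g x + (f' x a + c * f' x b) / 2 * g x"
  unfolding wirtinger_mult[OF C1_withD(1)[OF assms(1,3)] C1_withD(1)[OF assms(2,3)]]
    wirtinger_eq[OF C1_withD(1)[OF assms(1,3)]] ..

lemma C1_with_const: "C1_with (\<lambda>_. c) (\<lambda>_ _. 0)"
  by (simp add: C1_with_def)

lemma C1_with_linear:
  assumes "bounded_linear f"
  shows "C1_with f (\<lambda>_. f)"
  by (simp add: C1_with_def bounded_linear_imp_has_derivative[OF assms])

context adjoint_weight
begin

text \<open>The vector field d/dzbar - w d/dz has divergence zero, so passing to the strong form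
  only changes the sign of the derivatives of \<rho>.\<close>

lemma equation_a:
  assumes "x \<in> Dom"
  shows "snd x * dz (\<lambda>x. complex_of_real (\<rho> x)) x - dzb (\<lambda>x. complex_of_real (\<rho> x)) x = fst x * of_real (\<rho> x)"
proof -
  interpret W: weak_equation \<rho> "\<lambda>x. - snd x" "\<lambda>_. 1" "\<lambda>_. 0" "\<lambda>_. 0" fst
  proof (rule weak_equation_from_adjoint[OF adj_a])
    show "tame (op_a (zw_power m n))" "tame (op_adag (zw_power m n))" for m n
      unfolding op_zw_power by (intro tame_intros tame_zw_power)+
    show "mon_deriv (\<lambda>x. - snd x) (\<lambda>_. 1) (\<lambda>_. 0) (\<lambda>_. 0) a b c d x - fst x * mon a b c d x
      = cnj (op_a (zw_power b d) x) * zw_power a c x - cnj (zw_power b d x) * op_adag (zw_power a c) x" for a b c d x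
      by (simp add: op_zw_power zw_power_apply mon_deriv_def mon_def algebra_simps)
  qed (intro ops_hol_L2 tame_intros)+
  obtain r' where r: "C1_with (\<lambda>x. complex_of_real (\<rho> x)) r'" using C1_with_complex by blast
  have s: "C1_with (\<lambda>x. - snd x :: complex) (\<lambda>_ h. - snd h)"
    by (intro C1_with_linear bounded_linear_minus bounded_linear_snd)
  note const = C1_with_const
  from W.strong_equation[OF r s const const const assms] show ?thesis
    unfolding wirtinger_simps wirtinger_mult_C1[OF s r assms] wirtinger_mult_C1[OF const r assms]
    by (simp add: algebra_simps)
qed

text \<open>The field is d/dwb - zw d/dz - w^2 d/dw. Its divergence -w - 2w is added to the term 2kw
  of \<open>op_Kplus\<close> and produces the coefficient 2k - 3.\<close>

lemma equation_K:
  assumes "x \<in> Dom"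
  shows "(snd x)\<^sup>2 * dw (\<lambda>x. complex_of_real (\<rho> x)) x - dwb (\<lambda>x. complex_of_real (\<rho> x)) x
    = ((fst x)\<^sup>2 / 2 + of_real (2 * k - 3) * snd x) * of_real (\<rho> x)
      - fst x * snd x * dz (\<lambda>x. complex_of_real (\<rho> x)) x"
proof -
  interpret W: weak_equation \<rho> "\<lambda>x. - (fst x * snd x)" "\<lambda>_. 0" "\<lambda>x. - (snd x)\<^sup>2" "\<lambda>_. 1"
    "\<lambda>x. 1 / 2 * (fst x)\<^sup>2 + 2 * of_real k * snd x"
  proof (rule weak_equation_from_adjoint[OF adj_K])
    show "tame (op_Kminus (zw_power m n))" "tame (op_Kplus k (zw_power m n))" for m n
      unfolding op_zw_power by (intro tame_intros tame_zw_power)+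
    show "mon_deriv (\<lambda>x. - (fst x * snd x)) (\<lambda>_. 0) (\<lambda>x. - (snd x)\<^sup>2) (\<lambda>_. 1) a b c d x
        - (1 / 2 * (fst x)\<^sup>2 + 2 * of_real k * snd x) * mon a b c d x
      = cnj (op_Kminus (zw_power b d) x) * zw_power a c x - cnj (zw_power b d x) * op_Kplus k (zw_power a c) x" for a b c d x
      by (cases a; cases c)
        (simp_all add: op_zw_power zw_power_apply mon_deriv_def mon_def power2_eq_square algebra_simps)
  qed (intro ops_hol_L2 tame_intros)+
  obtain r' where r: "C1_with (\<lambda>x. complex_of_real (\<rho> x)) r'" using C1_with_complex by blast
  have s1: "C1_with (\<lambda>x. - (fst x * snd x) :: complex) (\<lambda>x h. - (fst x * snd h + fst h * snd x))"
    unfolding C1_with_def by (intro conjI ballI allI) (auto intro!: derivative_eq_intros continuous_intros)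
  have s3: "C1_with (\<lambda>x. - (snd x)\<^sup>2 :: complex) (\<lambda>x h. - (2 * snd x * snd h))"
    unfolding C1_with_def by (intro conjI ballI allI) (auto intro!: derivative_eq_intros continuous_intros)
  note const = C1_with_const
  from W.strong_equation[OF r s1 const s3 const assms] show ?thesis
    unfolding wirtinger_simps wirtinger_mult_C1[OF s1 r assms] wirtinger_mult_C1[OF s3 r assms]
      wirtinger_mult_C1[OF const r assms]
    by (simp add: algebra_simps add_eq_0_iff)
qed

text \<open>As k is real, it cancels between the two sides of the adjointness relation, leaving q =
  0; the divergences of the holomorphic and conjugate parts cancel as well.\<close>

lemma equation_0:
  assumes "x \<in> Dom"
  shows "2 * (snd x * dw (\<lambda>x. complex_of_real (\<rho> x)) x - cnj (snd x) * dwb (\<lambda>x. complex_of_real (\<rho> x)) x)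
    = cnj (fst x) * dzb (\<lambda>x. complex_of_real (\<rho> x)) x - fst x * dz (\<lambda>x. complex_of_real (\<rho> x)) x"
proof -
  interpret W: weak_equation \<rho> "\<lambda>x. - 1 / 2 * fst x" "\<lambda>x. 1 / 2 * cnj (fst x)" "\<lambda>x. - snd x" "\<lambda>x. cnj (snd x)" "\<lambda>_. 0"
  proof (rule weak_equation_from_adjoint[OF adj_0])
    show "tame (op_K0 k (zw_power m n))" "tame (op_K0 k (zw_power m n))" for m n
      unfolding op_zw_power by (intro tame_intros tame_zw_power)+
    show "mon_deriv (\<lambda>x. - 1 / 2 * fst x) (\<lambda>x. 1 / 2 * cnj (fst x)) (\<lambda>x. - snd x) (\<lambda>x. cnj (snd x)) a b c d x
        - 0 * mon a b c d x
      = cnj (op_K0 k (zw_power b d) x) * zw_power a c x - cnj (zw_power b d x) * op_K0 k (zw_power a c) x" for a b c d x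
      by (cases a; cases b; cases c; cases d)
        (simp_all add: op_zw_power zw_power_apply mon_deriv_def mon_def field_simps)
  qed (intro ops_hol_L2 tame_intros)+
  obtain r' where r: "C1_with (\<lambda>x. complex_of_real (\<rho> x)) r'" using C1_with_complex by blast
  have s: "C1_with (\<lambda>x. - 1 / 2 * fst x :: complex) (\<lambda>_ h. - 1 / 2 * fst h)"
    "C1_with (\<lambda>x. 1 / 2 * cnj (fst x) :: complex) (\<lambda>_ h. 1 / 2 * cnj (fst h))"
    "C1_with (\<lambda>x. - snd x :: complex) (\<lambda>_ h. - snd h)"
    "C1_with (\<lambda>x. cnj (snd x) :: complex) (\<lambda>_ h. cnj (snd h))"
    unfolding C1_with_def by (intro conjI ballI allI; auto intro!: derivative_eq_intros continuous_intros)+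
  from W.strong_equation[OF r s assms] show ?thesis
    unfolding wirtinger_simps wirtinger_mult_C1[OF s(1) r assms] wirtinger_mult_C1[OF s(2) r assms]
      wirtinger_mult_C1[OF s(3) r assms] wirtinger_mult_C1[OF s(4) r assms]
    by (simp add: field_simps)
qed

lemma weight_equations: "weight_equations (2 * k - 3) \<rho>"
  unfolding weight_equations_def Let_def
  using equation_a equation_K equation_0 by fastforce

end

theorem proposition2:
  fixes k p :: real
  assumes "k > 0" and "p = 2 * k - 3"
  shows "(\<forall>\<rho> :: complex \<times> complex \<Rightarrow> real.
            4 * k \<noteq> 3 \<longrightarrow>
            C1_on_Dom \<rho> \<longrightarrow>
            (\<forall>x\<in>Dom. 0 \<le> (4 * k - 3) * \<rho> x) \<longrightarrow>
            (\<forall>m n. (\<lambda>(z, w). z ^ m * w ^ n) \<in> hol_L2 \<rho>) \<longrightarrow>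
            adjoint_cond k \<rho> op_a op_adag \<longrightarrow>
            adjoint_cond k \<rho> op_Kminus (op_Kplus k) \<longrightarrow>
            adjoint_cond k \<rho> (op_K0 k) (op_K0 k) \<longrightarrow>
            weight_equations p \<rho>)
         \<and> C1_on_Dom (weight_solution p) \<and> weight_equations p (weight_solution p)"
proof (intro conjI allI impI C1_on_Dom_weight_solution weight_equations_weight_solution)
  fix \<rho> :: "complex \<times> complex \<Rightarrow> real"
  assume "4 * k \<noteq> 3" "C1_on_Dom \<rho>" "\<forall>x\<in>Dom. 0 \<le> (4 * k - 3) * \<rho> x"
    "\<forall>m n. (\<lambda>(z, w). z ^ m * w ^ n) \<in> hol_L2 \<rho>"
    "adjoint_cond k \<rho> op_a op_adag" "adjoint_cond k \<rho> op_Kminus (op_Kplus k)"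
    "adjoint_cond k \<rho> (op_K0 k) (op_K0 k)"
  then interpret adjoint_weight k \<rho>
    by unfold_locales (auto simp: zw_power_def)
  show "weight_equations p \<rho>"
    unfolding assms(2) by (rule weight_equations)
qed

end
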